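(* Assume $0<r<q$ and that the parameters are regular and admissible. Let $(\boldsymbol n,\boldsymbol m)\in\mathbb N_0^p\times\mathbb N_0^q$ with $|\boldsymbol m|=|\boldsymbol n|+1$ and $\boldsymbol m$ near the diagonal, and let $\mathbf S^{\boldsymbol a}_{\boldsymbol n,\boldsymbol m}$ be the finite Laurent seed (for some fixed $\gamma\in\mathbb C\setminus\{0\}$) defined in the context. Let $\omega$ be any word of length $|\boldsymbol n|$ in which each index $i\in\{1,\dots,p\}$ occurs exactly $n_i$ times. Then, up to a nonzero normalization constant, $$\mathbf B_{\boldsymbol n,\boldsymbol m}(z)=\mathcal U^{\boldsymbol a}_\omega\big[\mathbf S^{\boldsymbol a}_{\boldsymbol n,\boldsymbol m}\big](z).$$ (The remaining scalar is fixed by requiring a chosen component $j$ with $m_j=\max_hm_h$ to be monic.)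
   Context: Notation. $\mathbf 1_d$: all-ones vector; $\boldsymbol e_j$: standard basis vector; $|\boldsymbol n|=\sum n_i$; $\boldsymbol c^{*j}$: $\boldsymbol c$ with $j$-th component removed. $(x)_n=\Gamma(x+n)/\Gamma(x)=x(x+1)\cdots(x+n-1)$; for vectors $\Gamma(\boldsymbol v)=\prod_h\Gamma(v_h)$, $(\boldsymbol c)_{\boldsymbol m}=\prod_h(c_h)_{m_h}$, a scalar subscript is applied to each component; empty products are $1$. $\mathbb P_N$: polynomials of degree $\le N$, $\mathbb P_{-1}=\{0\}$. $\mathbb T$: positively oriented unit circle. $\mathbb Z_{\le0}=\{0,-1,\dots\}$. Parameters: $p,q\ge1$, $\boldsymbol a\in\mathbb C^r$, $\boldsymbol b\in\mathbb C^q$, $\boldsymbol\kappa\in\mathbb C^p$. Regular: $b_j-b_h\notin\mathbb Z$ $(j\ne h)$, $\kappa_i-\kappa_h\notin\mathbb Z$ $(i\ne h)$. Near the diagonal: $|m_j-m_h|\le1$ for all $j,h$; $m_*=\max_jm_j$, $d=m_*-1$, $N=|\boldsymbol n|$. Admissible: for all $i,j,\rho$: $\kappa_i+a_\rho+1\notin\mathbb Z_{\le0}$, $\kappa_i+b_j+1\notin\mathbb Z_{\le0}$, $a_\rho-b_j-(m_*-1)\notin\mathbb Z_{\le0}$. Weights: $C_{j,i}(z)=\sum_{k\ge0}\frac{\Gamma((k+\kappa_i)\mathbf 1_r+\boldsymbol a+\mathbf 1_r)}{\Gamma((k+\kappa_i)\mathbf 1_q+\boldsymbol b+\boldsymbol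 e_j+\mathbf 1_q)}z^{-k-1}$, $z\neq0$. $\mathbf B_{\boldsymbol n,\boldsymbol m}$ denotes the $B$-polynomial vector: the nonzero row vector $(B^{(1)},\dots,B^{(q)})$, unique up to a nonzero scalar under these hypotheses, with $B^{(j)}\in\mathbb P_{m_j-1}$ and $\sum_{j=1}^q\oint_{\mathbb T}z^\ell B^{(j)}(z)C_{j,i}(z)\frac{\mathrm dz}{2\pi\mathrm i}=0$ for $1\le i\le p$, $0\le\ell\le n_i-1$. Operators on $\mathbf P\in\mathbb C[z,z^{-1}]^{1\times q}$: $\vartheta=z\,\mathrm d/\mathrm dz$, $D=\operatorname{diag}(b_1,\dots,b_q)$, $\lambda^{\boldsymbol a}_j=\dfrac{\prod_{\rho=1}^r(a_\rho-b_j)}{\prod_{\ell\ne j}(b_\ell-b_j)}$, $\lambda^{\boldsymbol a}=(\lambda^{\boldsymbol a}_1,\dots,\lambda^{\boldsymbol a}_q)$, $$\mathcal T^{\boldsymbol a}_{i,s}[\mathbf P]=-z\big(\vartheta\mathbf P+\mathbf PD+(\kappa_i+s+2)\mathbf P\big)+(\mathbf P\mathbf 1_q^{\mathsf T})\lambda^{\boldsymbol a}.$$ For a word $\omega=(i_0,\dots,i_{N-1})$ put $\rho_c=\#\{c'>c:i_{c'}=i_c\}$, $s_c=N-1-c+\rho_c$, and $\mathcal U^{\boldsymbol a}_\omega=\mathcal T^{\boldsymbol a}_{i_{N-1},s_{N-1}}\cdots\mathcal T^{\boldsymbol a}_{i_0,s_0}$ (rightmost factor first; identity if $N=0$). Finite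 Laurent seed. Let $R(u)=\gamma/(u\mathbf 1_q+\boldsymbol b)_{\boldsymbol m}$ and, for $0\le e\le d$, $1\le j\le q$, $$\Phi_{e,j}(u)=\frac{(u\mathbf 1_r+\boldsymbol a)_{d-e}}{(u+b_j)_{d-e+1}\,(u\mathbf 1_{q-1}+\boldsymbol b^{*j})_{d-e}} .$$ Define $s_{e,j}$ recursively in $e=0,1,\dots,d$ by $$s_{e,j}=\frac{\operatorname{Res}_{u=-b_j-d+e}R(u)-\sum_{\alpha=0}^{e-1}\sum_{h=1}^qs_{\alpha,h}\operatorname{Res}_{u=-b_j-d+e}\Phi_{\alpha,h}(u)}{\operatorname{Res}_{u=-b_j-d+e}\Phi_{e,j}(u)},$$ and set $\mathbf S^{\boldsymbol a}_{\boldsymbol n,\boldsymbol m}(z)=z^{d-N}\sum_{e=0}^d\mathbf s_e z^{-e}$ with $\mathbf s_e=(s_{e,1},\dots,s_{e,q})$. *)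

theory Defs
  imports
    "HOL-Complex_Analysis.Complex_Analysis"
    "HOL-Computational_Algebra.Computational_Algebra"
begin

text \<open>
  The dimensions p, q, r are the cardinalities of the (finite, nonempty) index types
  \<open>'p\<close>, \<open>'q\<close>, \<open>'r\<close>.
\<close>

definition msize :: "nat ^ 'k::finite \<Rightarrow> nat" where
  "msize n = (\<Sum>i\<in>UNIV. n $ i)"

definition max_entry :: "nat ^ 'k::finite \<Rightarrow> nat" where
  "max_entry m = Max (range (\<lambda>j. m $ j))"

definition regular :: "complex ^ 'q::finite \<Rightarrow> complex ^ 'p::finite \<Rightarrow> bool" where
  "regular b \<kappa> \<longleftrightarrow>
     (\<forall>j h. j \<noteq> h \<longrightarrow> b $ j - b $ h \<notin> \<int>) \<and>
     (\<forall>i h. i \<noteq> h \<longrightarrow> \<kappa> $ i - \<kappa> $ h \<notin> \<int>)"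

definition near_diagonal :: "nat ^ 'q::finite \<Rightarrow> bool" where
  "near_diagonal m \<longleftrightarrow> (\<forall>j h. \<bar>int (m $ j) - int (m $ h)\<bar> \<le> 1)"

definition admissible ::
  "complex ^ 'r::finite \<Rightarrow> complex ^ 'q::finite \<Rightarrow> complex ^ 'p::finite \<Rightarrow> nat ^ 'q \<Rightarrow> bool" where
  "admissible a b \<kappa> m \<longleftrightarrow> (\<forall>i j \<rho>.
     \<kappa> $ i + a $ \<rho> + 1 \<notin> \<int>\<^sub>\<le>\<^sub>0 \<and>
     \<kappa> $ i + b $ j + 1 \<notin> \<int>\<^sub>\<le>\<^sub>0 \<and>
     a $ \<rho> - b $ j - (of_nat (max_entry m) - 1) \<notin> \<int>\<^sub>\<le>\<^sub>0)"

definition weight ::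
  "complex ^ 'r::finite \<Rightarrow> complex ^ 'q::finite \<Rightarrow> complex ^ 'p::finite \<Rightarrow>
   'q \<Rightarrow> 'p \<Rightarrow> complex \<Rightarrow> complex" where
  "weight a b \<kappa> j i z =
     (\<Sum>k. (\<Prod>\<rho>\<in>UNIV. Gamma (of_nat k + \<kappa> $ i + a $ \<rho> + 1)) /
          (\<Prod>h\<in>UNIV. Gamma (of_nat k + \<kappa> $ i + b $ h + axis j 1 $ h + 1)) *
          z powi (- int k - 1))"

text \<open>
  Being a B-polynomial vector for \<open>(n, m)\<close>; the first disjunct of the degree condition
  accounts for the convention that the polynomials of degree at most -1 are just 0.
\<close>

definition is_B_vector ::
  "complex ^ 'r::finite \<Rightarrow> complex ^ 'q::finite \<Rightarrow> complex ^ 'p::finite \<Rightarrow>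
   nat ^ 'p \<Rightarrow> nat ^ 'q \<Rightarrow> complex poly ^ 'q \<Rightarrow> bool" where
  "is_B_vector a b \<kappa> n m B \<longleftrightarrow>
     B \<noteq> 0 \<and>
     (\<forall>j. B $ j = 0 \<or> degree (B $ j) < m $ j) \<and>
     (\<forall>i l. l < n $ i \<longrightarrow>
        (\<Sum>j\<in>UNIV. contour_integral (circlepath 0 1)
           (\<lambda>z. z ^ l * poly (B $ j) z * weight a b \<kappa> j i z / (2 * of_real pi * \<i>))) = 0)"

text \<open>
  Row vectors of Laurent polynomials in \<open>z\<close> are represented by vectors of formal Laurent
  series, with \<open>z\<close> being \<open>fls_X\<close>.
\<close>

definition laurent_of_polys :: "complex poly ^ 'q::finite \<Rightarrow> complex fls ^ 'q" where
  "laurent_of_polys B = (\<chi> j. fps_to_fls (fps_of_poly (B $ j)))"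

definition lam :: "complex ^ 'r::finite \<Rightarrow> complex ^ 'q::finite \<Rightarrow> 'q \<Rightarrow> complex" where
  "lam a b j = (\<Prod>\<rho>\<in>UNIV. a $ \<rho> - b $ j) / (\<Prod>l\<in>UNIV - {j}. b $ l - b $ j)"

definition raise_op ::
  "complex ^ 'r::finite \<Rightarrow> complex ^ 'q::finite \<Rightarrow> complex ^ 'p::finite \<Rightarrow>
   'p \<Rightarrow> nat \<Rightarrow> complex fls ^ 'q \<Rightarrow> complex fls ^ 'q" where
  "raise_op a b \<kappa> i s P = (\<chi> j.
     - fls_X * (fls_X * fls_deriv (P $ j) + P $ j * fls_const (b $ j)
                + fls_const (\<kappa> $ i + of_nat s + 2) * P $ j)
     + (\<Sum>h\<in>UNIV. P $ h) * fls_const (lam a b j))"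

definition word_shift :: "'p list \<Rightarrow> nat \<Rightarrow> nat" where
  "word_shift w c =
     length w - 1 - c + card {c'. c < c' \<and> c' < length w \<and> w ! c' = w ! c}"

text \<open>Folding along \<open>[0, ..., N - 1]\<close> applies the operator of the first letter first.\<close>

definition word_op ::
  "complex ^ 'r::finite \<Rightarrow> complex ^ 'q::finite \<Rightarrow> complex ^ 'p::finite \<Rightarrow>
   'p list \<Rightarrow> complex fls ^ 'q \<Rightarrow> complex fls ^ 'q" where
  "word_op a b \<kappa> w =
     fold (\<lambda>c. raise_op a b \<kappa> (w ! c) (word_shift w c)) [0..<length w]"

definition seed_R :: "complex ^ 'q::finite \<Rightarrow> nat ^ 'q \<Rightarrow> complex \<Rightarrow> complex \<Rightarrow> complex" where
  "seed_R b m \<gamma> u = \<gamma> / (\<Prod>h\<in>UNIV. pochhammer (u + b $ h) (m $ h))"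

definition seed_Phi ::
  "complex ^ 'r::finite \<Rightarrow> complex ^ 'q::finite \<Rightarrow> nat \<Rightarrow> nat \<Rightarrow> 'q \<Rightarrow> complex \<Rightarrow> complex" where
  "seed_Phi a b d e j u =
     (\<Prod>\<rho>\<in>UNIV. pochhammer (u + a $ \<rho>) (d - e)) /
     (pochhammer (u + b $ j) (d - e + 1) *
      (\<Prod>h\<in>UNIV - {j}. pochhammer (u + b $ h) (d - e)))"

definition depth :: "nat ^ 'q::finite \<Rightarrow> nat" where
  "depth m = max_entry m - 1"

fun seed_coeff ::
  "complex ^ 'r::finite \<Rightarrow> complex ^ 'q::finite \<Rightarrow> nat ^ 'q \<Rightarrow> complex \<Rightarrow>
   nat \<Rightarrow> 'q \<Rightarrow> complex" where
  "seed_coeff a b m \<gamma> e j =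
     (let u\<^sub>0 = - (b $ j) - of_nat (depth m) + of_nat e in
       (residue (seed_R b m \<gamma>) u\<^sub>0
        - (\<Sum>\<alpha>\<in>{..<e}. \<Sum>h\<in>UNIV.
             seed_coeff a b m \<gamma> \<alpha> h * residue (seed_Phi a b (depth m) \<alpha> h) u\<^sub>0))
       / residue (seed_Phi a b (depth m) e j) u\<^sub>0)"

declare seed_coeff.simps [simp del]

definition seed ::
  "complex ^ 'r::finite \<Rightarrow> complex ^ 'q::finite \<Rightarrow> nat ^ 'p::finite \<Rightarrow> nat ^ 'q \<Rightarrow> complex \<Rightarrow>
   complex fls ^ 'q" where
  "seed a b n m \<gamma> = (\<chi> j.
     fls_X_intpow (int (depth m) - int (msize n)) *
     (\<Sum>e\<le>depth m. fls_const (seed_coeff a b m \<gamma> e j) * fls_X_intpow (- int e)))"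

end

theory Submission
  imports Defs
begin

text \<open>
  Write \<open>G(t) = \<Prod>\<Gamma>(t + a + 1) / \<Prod>\<Gamma>(t + b + 1)\<close>. The integral of
  \<open>z\<^bsup>l + k\<^esup>\<close> against a weight is \<open>G(t) \<Phi>(t + 1)\<close> with \<open>t = \<kappa> + l\<close>, where \<open>\<Phi>\<close> is one of the
  rational functions of the seed. Sending a coefficient vector to the corresponding combination
  of these functions, and clearing the common denominator \<open>\<Prod>\<^sub>h \<Prod>\<^sub>s (u + b\<^sub>h + s)\<close>, turns it into a
  polynomial, its symbol. Orthogonality says that the symbol vanishes at the nodes
  \<open>\<kappa>\<^sub>i + l + 1\<close>. The symbol map is triangular with respect to evaluation at the poles
  \<open>- b\<^sub>j - k\<close>, hence injective, and the degree bounds on the components say that it also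
  vanishes at some of the points \<open>- b\<^sub>j - d\<close>; counting roots yields uniqueness up to a scalar.
  The residue recursion makes the symbol of the seed equal to the numerator of \<open>R\<close>, and each
  operator multiplies the symbol by one linear factor. That every operator also raises the lowest
  exponent is forced by the degree: the lowest coefficients sum to the leading
  coefficient of the symbol, which is zero as long as factors are missing.
\<close>

no_notation fps_nth (infixl "$" 75)

section \<open>Linear factors, common denominator and symbols\<close>

definition lin :: "complex \<Rightarrow> complex poly" where
  "lin x = [:x, 1:]"

definition denom :: "complex ^ 'q::finite \<Rightarrow> nat \<Rightarrow> complex poly" where
  "denom b d = (\<Prod>h\<in>UNIV. \<Prod>s\<in>{0..d}. lin (b $ h + of_nat s))"

text \<open>With G as in the overview, this is G(u - 1 + k) / G(u - 1) multiplied by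
  \<open>denom b d\<close>, for \<open>k \<le> Suc d\<close>; at \<open>k = Suc d\<close> the second
  product is empty.\<close>

definition Gpoly ::
  "complex ^ 'r::finite \<Rightarrow> complex ^ 'q::finite \<Rightarrow> nat \<Rightarrow> nat \<Rightarrow> complex poly" where
  "Gpoly a b d k = (\<Prod>\<rho>\<in>UNIV. \<Prod>s\<in>{0..<k}. lin (a $ \<rho> + of_nat s)) *
     (\<Prod>h\<in>UNIV. \<Prod>s\<in>{k..d}. lin (b $ h + of_nat s))"

text \<open>The numerator of \<open>seed_Phi a b d (d - k) j\<close> over \<open>denom b d\<close>.
  The index k is the exponent of z counted from the lowest one, so it runs against the seed index
  e.\<close>

definition Psi ::
  "complex ^ 'r::finite \<Rightarrow> complex ^ 'q::finite \<Rightarrow> nat \<Rightarrow> nat \<Rightarrow> 'q \<Rightarrow> complex poly" where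
  "Psi a b d k j = (\<Prod>\<rho>\<in>UNIV. \<Prod>s\<in>{0..<k}. lin (a $ \<rho> + of_nat s)) *
     ((\<Prod>s\<in>{Suc k..d}. lin (b $ j + of_nat s)) *
      (\<Prod>h\<in>UNIV - {j}. \<Prod>s\<in>{k..d}. lin (b $ h + of_nat s)))"

definition symbol ::
  "complex ^ 'r::finite \<Rightarrow> complex ^ 'q::finite \<Rightarrow> nat \<Rightarrow> (nat \<Rightarrow> 'q \<Rightarrow> complex) \<Rightarrow> complex poly" where
  "symbol a b d p = (\<Sum>k\<le>d. \<Sum>j\<in>UNIV. smult (p k j) (Psi a b d k j))"

lemma poly_lin [simp]: "poly (lin x) u = u + x"
  by (simp add: lin_def add.commute)

lemma lin_nonzero [simp]: "lin x \<noteq> 0"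
  by (simp add: lin_def)

lemma degree_lin [simp]: "degree (lin x) = 1"
  by (simp add: lin_def)

lemma lead_coeff_lin: "lead_coeff (lin x) = 1"
  by (simp add: lin_def)

lemma degree_prod_lin [simp]: "degree (\<Prod>s\<in>S. lin (f s)) = card S"
  by (cases "finite S") (simp_all add: degree_prod_sum_eq)

text \<open>\<open>Psi\<close> lacks exactly one factor of \<open>Gpoly\<close>, the one that
  vanishes at the pole - b_j - k.\<close>

lemma lin_times_Psi:
  assumes "k \<le> d"
  shows "lin (b $ j + of_nat k) * Psi a b d k j = Gpoly a b d k"
proof -
  have "(\<Prod>s\<in>{k..d}. lin (b $ j + of_nat s)) =
      lin (b $ j + of_nat k) * (\<Prod>s\<in>{Suc k..d}. lin (b $ j + of_nat s))"
    using assms by (simp add: prod.atLeast_Suc_atMost)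
  then show ?thesis
    unfolding Gpoly_def Psi_def
    by (subst prod.remove[of UNIV j]) (simp_all add: mult_ac)
qed

text \<open>The hypothesis \<open>r < q\<close> enters through this partial fraction expansion of
  \<open>\<Prod>(u + a) / \<Prod>(u + b)\<close>.\<close>

lemma sum_lam_lagrange:
  fixes a :: "complex ^ 'r::finite" and b :: "complex ^ 'q::finite"
  assumes rq: "CARD('r) < CARD('q)" and inj: "inj (\<lambda>j. b $ j)"
  shows "(\<Sum>j\<in>UNIV. smult (lam a b j) (\<Prod>h\<in>UNIV - {j}. lin (b $ h + x))) =
    (\<Prod>\<rho>\<in>UNIV. lin (a $ \<rho> + x))"
proof (rule poly_eqI_degree[where A = "(\<lambda>j. - b $ j - x) ` UNIV"])
  have "inj (\<lambda>j. - b $ j - x)"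
    using inj by (auto simp: inj_on_def)
  then have card: "card ((\<lambda>j. - b $ j - x) ` UNIV) = CARD('q)"
    by (simp add: card_image)
  have "degree (\<Sum>j\<in>UNIV. smult (lam a b j) (\<Prod>h\<in>UNIV - {j}. lin (b $ h + x))) \<le> CARD('q) - 1"
    by (rule degree_sum_le) (auto intro!: order.trans[OF degree_smult_le])
  then show "degree (\<Sum>j\<in>UNIV. smult (lam a b j) (\<Prod>h\<in>UNIV - {j}. lin (b $ h + x)))
      < card ((\<lambda>j. - b $ j - x) ` UNIV)"
    unfolding card using zero_less_card_finite[where 'a = 'q] by linarith
  show "degree (\<Prod>\<rho>\<in>UNIV. lin (a $ \<rho> + x)) < card ((\<lambda>j. - b $ j - x) ` UNIV)"
    using rq by (simp add: card)
next
  fix u assume "u \<in> (\<lambda>j. - b $ j - x) ` UNIV"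
  then obtain i where u: "u = - b $ i - x" by auto
  have "poly (\<Sum>j\<in>UNIV. smult (lam a b j) (\<Prod>h\<in>UNIV - {j}. lin (b $ h + x))) u =
      (\<Sum>j\<in>UNIV. lam a b j * (\<Prod>h\<in>UNIV - {j}. b $ h - b $ i))"
    by (simp add: poly_sum poly_prod u)
  also have "\<dots> = lam a b i * (\<Prod>h\<in>UNIV - {i}. b $ h - b $ i)"
    by (subst sum.remove[of _ i]) (fastforce intro!: sum.neutral)+
  also have "\<dots> = (\<Prod>\<rho>\<in>UNIV. a $ \<rho> - b $ i)"
  proof -
    have "(\<Prod>h\<in>UNIV - {i}. b $ h - b $ i) \<noteq> 0"
      using inj by (auto simp: inj_on_def)
    then show ?thesis by (simp add: lam_def)
  qed
  finally show "poly (\<Sum>j\<in>UNIV. smult (lam a b j) (\<Prod>h\<in>UNIV - {j}. lin (b $ h + x))) u =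
      poly (\<Prod>\<rho>\<in>UNIV. lin (a $ \<rho> + x)) u"
    by (simp add: poly_prod u)
qed

text \<open>After the factors common to all j are pulled out, the Lagrange identity at shift k
  remains. The lemma shows that the rank-one part of the operators moves level k to level k +
  1.\<close>

lemma sum_lam_Psi:
  fixes a :: "complex ^ 'r::finite" and b :: "complex ^ 'q::finite"
  assumes "CARD('r) < CARD('q)" "inj (\<lambda>j. b $ j)" "k \<le> d"
  shows "(\<Sum>j\<in>UNIV. smult (lam a b j) (Psi a b d k j)) = Gpoly a b d (Suc k)"
proof -
  let ?A = "\<Prod>\<rho>\<in>UNIV. \<Prod>s\<in>{0..<k}. lin (a $ \<rho> + of_nat s)"
  let ?B = "\<Prod>h\<in>UNIV. \<Prod>s\<in>{Suc k..d}. lin (b $ h + of_nat s)"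
  have "Psi a b d k j = ?A * ?B * (\<Prod>h\<in>UNIV - {j}. lin (b $ h + of_nat k))" for j
  proof -
    have "(\<Prod>h\<in>UNIV - {j}. \<Prod>s\<in>{k..d}. lin (b $ h + of_nat s)) =
        (\<Prod>h\<in>UNIV - {j}. lin (b $ h + of_nat k)) *
        (\<Prod>h\<in>UNIV - {j}. \<Prod>s\<in>{Suc k..d}. lin (b $ h + of_nat s))"
      using assms(3) by (simp add: prod.atLeast_Suc_atMost prod.distrib)
    then show ?thesis
      unfolding Psi_def by (subst prod.remove[of UNIV j]) (simp_all add: mult_ac)
  qed
  then have "(\<Sum>j\<in>UNIV. smult (lam a b j) (Psi a b d k j)) =
      ?A * ?B * (\<Sum>j\<in>UNIV. smult (lam a b j) (\<Prod>h\<in>UNIV - {j}. lin (b $ h + of_nat k)))"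
    by (simp add: sum_distrib_left)
  also have "\<dots> = ?A * ?B * (\<Prod>\<rho>\<in>UNIV. lin (a $ \<rho> + of_nat k))"
    using assms by (simp add: sum_lam_lagrange)
  also have "\<dots> = Gpoly a b d (Suc k)"
    by (simp add: Gpoly_def prod.distrib mult_ac)
  finally show ?thesis .
qed

section \<open>Degrees and leading coefficients\<close>

text \<open>Stated additively to avoid truncated subtraction; the degree is q (d + 1) - 1 - (q - r)
  k.\<close>

lemma degree_Psi:
  fixes a :: "complex ^ 'r::finite" and b :: "complex ^ 'q::finite"
  assumes "k \<le> d"
  shows "degree (Psi a b d k j) + 1 + CARD('q) * k = CARD('q) * Suc d + CARD('r) * k"
proof -
  have dg: "degree (\<Prod>x\<in>S. \<Prod>s\<in>T. lin (f x s)) = card S * card T" for S :: "'c set" and T :: "'d set" and f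
  proof (cases "finite S \<and> finite T")
    case True
    then show ?thesis by (subst degree_prod_sum_eq) auto
  next
    case False
    then show ?thesis by auto
  qed
  have "degree (Psi a b d k j) = CARD('r) * k + ((d - k) + (CARD('q) - 1) * Suc (d - k))"
    unfolding Psi_def
    by (subst degree_mult_eq, simp, simp, subst degree_mult_eq, simp, simp)
       (use assms in \<open>simp add: dg Suc_diff_le\<close>)
  moreover obtain q' where "CARD('q) = Suc q'"
    using zero_less_card_finite[where 'a = 'q] gr0_implies_Suc by blast
  moreover obtain e where "d = k + e" using assms le_Suc_ex by blast
  ultimately show ?thesis by (simp add: algebra_simps)
qed

lemma lead_coeff_Psi [simp]: "lead_coeff (Psi a b d k j) = 1"
  unfolding Psi_def lead_coeff_mult lead_coeff_prod lead_coeff_lin by simp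

text \<open>Since r < q, each level k > 0 loses degree. Only level 0 reaches the maximal degree, so
  the top coefficient of a symbol sees only the lowest coefficients.\<close>

lemma coeff_Psi_top:
  fixes a :: "complex ^ 'r::finite" and b :: "complex ^ 'q::finite"
  assumes "CARD('r) < CARD('q)" "k \<le> d"
  shows "coeff (Psi a b d k j) (CARD('q) * Suc d - 1) = (if k = 0 then 1 else 0)"
proof (cases "k = 0")
  case True
  then have "degree (Psi a b d k j) = CARD('q) * Suc d - 1"
    using degree_Psi[of k d a b j] assms by simp
  with True show ?thesis using lead_coeff_Psi[of a b d k j] by simp
next
  case False
  then have "CARD('r) * k < CARD('q) * k" using assms by simp
  then have "degree (Psi a b d k j) < CARD('q) * Suc d - 1"
    using degree_Psi[OF assms(2), of a b j] by linarith
  with False show ?thesis by (simp add: coeff_eq_0)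
qed

lemma coeff_symbol_top:
  fixes a :: "complex ^ 'r::finite" and b :: "complex ^ 'q::finite"
  assumes "CARD('r) < CARD('q)"
  shows "coeff (symbol a b d p) (CARD('q) * Suc d - 1) = (\<Sum>j\<in>UNIV. p 0 j)"
proof -
  have "coeff (symbol a b d p) (CARD('q) * Suc d - 1) =
      (\<Sum>k\<le>d. \<Sum>j\<in>UNIV. p k j * (if k = 0 then 1 else 0))"
    unfolding symbol_def coeff_sum coeff_smult
    by (intro sum.cong refl arg_cong2[of _ _ _ _ "(*)"] coeff_Psi_top[OF assms]) simp
  also have "\<dots> = (\<Sum>k\<le>d. if k = 0 then (\<Sum>j\<in>UNIV. p k j) else 0)"
    by (intro sum.cong) auto
  finally show ?thesis by simp
qed

lemma degree_symbol:
  fixes a :: "complex ^ 'r::finite" and b :: "complex ^ 'q::finite"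
  assumes "CARD('r) < CARD('q)"
  shows "degree (symbol a b d p) < CARD('q) * Suc d"
proof -
  have "degree (Psi a b d k j) \<le> CARD('q) * Suc d - 1" if "k \<le> d" for k j
  proof -
    have "CARD('r) * k \<le> CARD('q) * k" using assms by simp
    then show ?thesis using degree_Psi[OF that, of a b j] by linarith
  qed
  then have "degree (symbol a b d p) \<le> CARD('q) * Suc d - 1"
    unfolding symbol_def
    by (intro degree_sum_le) (auto intro: order.trans[OF degree_smult_le])
  moreover have "CARD('q) * Suc d > 0" by simp
  ultimately show ?thesis by linarith
qed

lemma smult_sum_right: "smult c (sum f A) = (\<Sum>x\<in>A. smult c (f x))"
  by (induction A rule: infinite_finite_induct) (simp_all add: smult_add_right)

section \<open>Action of one operator on a symbol\<close>

text \<open>The \<open>lam\<close> part contributes \<open>Gpoly\<close> one level higher, and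
  reindexing brings it back to level k. There it is (u + b_j + k) times \<open>Psi\<close>, and
  subtracting (k + b_j + x) times \<open>Psi\<close> leaves the factor u - x, independent of k and
  j.\<close>

lemma symbol_step:
  fixes a :: "complex ^ 'r::finite" and b :: "complex ^ 'q::finite"
  assumes "CARD('r) < CARD('q)" "inj (\<lambda>j. b $ j)"
    and sum0: "(\<Sum>h\<in>UNIV. p 0 h) = 0"
    and above: "\<And>h. p (Suc d) h = 0"
    and step: "\<And>k j. k \<le> d \<Longrightarrow>
      p' k j = lam a b j * (\<Sum>h\<in>UNIV. p (Suc k) h) - (of_nat k + b $ j + x) * p k j"
  shows "symbol a b d p' = lin (- x) * symbol a b d p"
proof -
  have "(\<Sum>k\<le>d. \<Sum>j\<in>UNIV. smult (lam a b j * (\<Sum>h\<in>UNIV. p (Suc k) h)) (Psi a b d k j)) =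
      (\<Sum>k\<le>d. smult (\<Sum>h\<in>UNIV. p (Suc k) h) (Gpoly a b d (Suc k)))"
  proof (intro sum.cong refl)
    fix k assume "k \<in> {..d}"
    then show "(\<Sum>j\<in>UNIV. smult (lam a b j * (\<Sum>h\<in>UNIV. p (Suc k) h)) (Psi a b d k j)) =
        smult (\<Sum>h\<in>UNIV. p (Suc k) h) (Gpoly a b d (Suc k))"
      using assms(1,2) by (simp flip: sum_lam_Psi add: smult_sum_right mult.commute)
  qed
  also have "\<dots> = (\<Sum>k\<in>{1..Suc d}. smult (\<Sum>h\<in>UNIV. p k h) (Gpoly a b d k))"
    by (rule sum.reindex_bij_witness[of _ "\<lambda>k. k - 1" Suc]) auto
  \<comment> \<open>Both boundary terms vanish: k = 0 by \<open>sum0\<close>, k = d + 1 by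
    \<open>above\<close>.\<close>
  also have "\<dots> = (\<Sum>k\<in>{..d}. smult (\<Sum>h\<in>UNIV. p k h) (Gpoly a b d k))"
  proof -
    have "(\<Sum>k\<in>{..Suc d}. smult (\<Sum>h\<in>UNIV. p k h) (Gpoly a b d k)) =
        (\<Sum>k\<in>{1..Suc d}. smult (\<Sum>h\<in>UNIV. p k h) (Gpoly a b d k))"
      by (rule sum.mono_neutral_right) (use sum0 in \<open>auto simp: not_le less_Suc_eq_0_disj\<close>)
    then show ?thesis by (simp add: above)
  qed
  also have "\<dots> = (\<Sum>k\<le>d. \<Sum>j\<in>UNIV. smult (p k j) (lin (b $ j + of_nat k) * Psi a b d k j))"
    by (intro sum.cong refl) (simp add: lin_times_Psi smult_sum)
  finally have *: "(\<Sum>k\<le>d. \<Sum>j\<in>UNIV. smult (lam a b j * (\<Sum>h\<in>UNIV. p (Suc k) h)) (Psi a b d k j)) =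
      (\<Sum>k\<le>d. \<Sum>j\<in>UNIV. smult (p k j) (lin (b $ j + of_nat k) * Psi a b d k j))" .
  have "symbol a b d p' =
     (\<Sum>k\<le>d. \<Sum>j\<in>UNIV. smult (lam a b j * (\<Sum>h\<in>UNIV. p (Suc k) h)) (Psi a b d k j)) -
     (\<Sum>k\<le>d. \<Sum>j\<in>UNIV. smult ((of_nat k + b $ j + x) * p k j) (Psi a b d k j))"
    unfolding symbol_def sum_subtractf[symmetric]
    by (intro sum.cong refl) (simp add: step smult_diff_left)
  also have "\<dots> = (\<Sum>k\<le>d. \<Sum>j\<in>UNIV. smult (p k j) (lin (b $ j + of_nat k) * Psi a b d k j) -
      smult ((of_nat k + b $ j + x) * p k j) (Psi a b d k j))"
    unfolding * by (simp add: sum_subtractf)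
  also have "\<dots> = (\<Sum>k\<le>d. \<Sum>j\<in>UNIV. lin (- x) * smult (p k j) (Psi a b d k j))"
  proof (intro sum.cong refl)
    fix k j
    show "smult (p k j) (lin (b $ j + of_nat k) * Psi a b d k j) -
      smult ((of_nat k + b $ j + x) * p k j) (Psi a b d k j) = lin (- x) * smult (p k j) (Psi a b d k j)"
      unfolding poly_eq_poly_eq_iff[symmetric] fun_eq_iff by (simp add: algebra_simps)
  qed
  also have "\<dots> = lin (- x) * symbol a b d p"
    by (simp add: symbol_def sum_distrib_left)
  finally show ?thesis .
qed

section \<open>Values at the poles\<close>

text \<open>Among the levels up to k, only \<open>Psi\<close> at (k, j) lacks the factor u + b_j +
  k. This is the triangularity of the symbol map.\<close>

lemma poly_Psi_eq_0:
  assumes "k \<le> d" "k' \<le> k" "(k', h) \<noteq> (k, j)"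
  shows "poly (Psi a b d k' h) (- b $ j - of_nat k) = 0"
proof (cases "h = j")
  case True
  then have "k \<in> {Suc k'..d}" using assms by auto
  with True show ?thesis by (auto simp: Psi_def poly_prod intro!: bexI[of _ k])
next
  case False
  have "(\<Prod>l\<in>UNIV - {h}. \<Prod>s = k'..d. - b $ j - of_nat k + (b $ l + of_nat s)) = 0"
    using False assms by (intro prod_zero bexI[of _ j] bexI[of _ k]) auto
  then show ?thesis by (simp add: Psi_def poly_prod)
qed

text \<open>A vanishing a-factor would make a_\<rho> - b_j - d equal to -(d + s - k), a nonpositive
  integer. A vanishing factor with h \<noteq> j would make b_h - b_j an integer, and for h = j the
  range starts above k.\<close>

lemma poly_Psi_neq_0:
  assumes "k \<le> d" and b: "\<And>j h. j \<noteq> h \<Longrightarrow> b $ j - b $ h \<notin> \<int>"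
    and a: "\<And>\<rho> j. a $ \<rho> - b $ j - of_nat d \<notin> \<int>\<^sub>\<le>\<^sub>0"
  shows "poly (Psi a b d k j) (- b $ j - of_nat k) \<noteq> 0"
proof -
  have 1: "- b $ j - of_nat k + (a $ \<rho> + of_nat s) \<noteq> 0" if "s < k" for s \<rho>
  proof
    assume "- b $ j - of_nat k + (a $ \<rho> + of_nat s) = 0"
    then have "a $ \<rho> - b $ j - of_nat d = - of_nat (d + s - k)"
      using assms(1) by (simp add: of_nat_diff algebra_simps)
    then show False using a by (metis minus_of_nat_in_nonpos_Ints)
  qed
  have 2: "- b $ j - of_nat k + (b $ h + of_nat s) \<noteq> 0" if "h \<noteq> j" for s h
  proof
    assume "- b $ j - of_nat k + (b $ h + of_nat s) = 0"
    then have "b $ h - b $ j = of_nat k - of_nat s" by (simp add: algebra_simps)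
    then show False using b[OF that] by simp
  qed
  show ?thesis
    unfolding Psi_def by (auto simp: poly_prod) (use 1 2 in \<open>auto\<close>)
qed

section \<open>Residues and the seed functions over the common denominator\<close>

lemma eventually_poly_neq_0:
  fixes P :: "complex poly"
  assumes "P \<noteq> 0"
  shows "\<forall>\<^sub>F u in at u\<^sub>0. poly P u \<noteq> 0"
proof -
  have "\<forall>\<^sub>F u in at u\<^sub>0. u \<in> - ({u. poly P u = 0} - {u\<^sub>0})"
    by (intro eventually_at_in_open' open_Compl finite_imp_closed finite_Diff poly_roots_finite assms) auto
  moreover have "\<forall>\<^sub>F u in at u\<^sub>0. u \<noteq> u\<^sub>0" by (rule eventually_neq_at_within)
  ultimately show ?thesis by eventually_elim auto
qed

lemma residue_poly_quotient:
  fixes P Q :: "complex poly"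
  assumes "poly Q u\<^sub>0 \<noteq> 0"
  shows "residue (\<lambda>u. poly P u / poly (lin (- u\<^sub>0) * Q) u) u\<^sub>0 = poly P u\<^sub>0 / poly Q u\<^sub>0"
proof -
  have "open {u. poly Q u \<noteq> 0}"
    by (intro open_Collect_neq continuous_intros)
  then have "residue (\<lambda>u. (poly P u / poly Q u) / (u - u\<^sub>0)) u\<^sub>0 = poly P u\<^sub>0 / poly Q u\<^sub>0"
    by (rule residue_simple) (use assms in \<open>auto intro!: holomorphic_intros\<close>)
  then show ?thesis by (simp add: mult.commute)
qed

lemma denom_nonzero [simp]: "denom b d \<noteq> 0"
  by (simp add: denom_def)

lemma denom_split:
  assumes "k \<le> d"
  shows "denom b d = lin (b $ j + of_nat k) * ((\<Prod>s\<in>{0..d} - {k}. lin (b $ j + of_nat s)) *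
      (\<Prod>h\<in>UNIV - {j}. \<Prod>s\<in>{0..d}. lin (b $ h + of_nat s)))"
  unfolding denom_def
  by (subst prod.remove[of UNIV j], simp, simp, subst prod.remove[of "{0..d}" k])
     (use assms in \<open>simp_all add: mult_ac\<close>)

text \<open>The numerator of \<open>seed_R\<close> over \<open>denom b d\<close>: where m_h = d, the
  product in \<open>seed_R\<close> stops before the factor u + b_h + d, which therefore reappears
  here.\<close>

definition Rhat :: "complex ^ 'q::finite \<Rightarrow> nat ^ 'q \<Rightarrow> nat \<Rightarrow> complex \<Rightarrow> complex poly" where
  "Rhat b m d \<gamma> = smult \<gamma> (\<Prod>h\<in>{h. m $ h = d}. lin (b $ h + of_nat d))"

lemma seed_R_eq:
  assumes m: "\<And>j. m $ j = d \<or> m $ j = Suc d" and "poly (denom b d) u \<noteq> 0"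
  shows "seed_R b m \<gamma> u = poly (Rhat b m d \<gamma>) u / poly (denom b d) u"
proof -
  have "poly (denom b d) u = (\<Prod>h\<in>UNIV. pochhammer (u + b $ h) (m $ h) *
      (if m $ h = d then u + (b $ h + of_nat d) else 1))"
    unfolding denom_def poly_prod
  proof (intro prod.cong refl)
    fix h
    have "(\<Prod>s = 0..d. poly (lin (b $ h + of_nat s)) u) = pochhammer (u + b $ h) (Suc d)"
      by (simp add: pochhammer_prod atLeastLessThanSuc_atLeastAtMost add.assoc)
    also have "\<dots> = pochhammer (u + b $ h) (m $ h) *
        (if m $ h = d then u + (b $ h + of_nat d) else 1)"
      using m[of h] by (auto simp: pochhammer_Suc add.assoc)
    finally show "(\<Prod>s = 0..d. poly (lin (b $ h + of_nat s)) u) = \<dots>" .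
  qed
  also have "\<dots> = (\<Prod>h\<in>UNIV. pochhammer (u + b $ h) (m $ h)) *
      (\<Prod>h\<in>{h. m $ h = d}. u + (b $ h + of_nat d))"
    by (simp add: prod.distrib prod.If_cases)
  finally have *: "poly (denom b d) u = (\<Prod>h\<in>UNIV. pochhammer (u + b $ h) (m $ h)) *
      (\<Prod>h\<in>{h. m $ h = d}. u + (b $ h + of_nat d))" .
  with assms(2) have "(\<Prod>h\<in>{h. m $ h = d}. u + (b $ h + of_nat d)) \<noteq> 0" by auto
  then show ?thesis
    unfolding * seed_R_def Rhat_def by (simp add: poly_prod)
qed

lemma seed_Phi_eq:
  assumes "k \<le> d" "poly (denom b d) u \<noteq> 0"
  shows "seed_Phi a b d (d - k) j u = poly (Psi a b d k j) u / poly (denom b d) u"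
proof -
  have poch: "pochhammer (u + x) n = (\<Prod>s=0..<n. poly (lin (x + of_nat s)) u)" for x n
    by (simp add: pochhammer_prod add.assoc)
  have split: "(\<Prod>s\<in>{0..d}. poly (lin (x + of_nat s)) u) =
      pochhammer (u + x) i * (\<Prod>s\<in>{i..d}. poly (lin (x + of_nat s)) u)" if "i \<le> Suc d" for x i
    unfolding poch using that prod.atLeastLessThan_concat[of 0 i "Suc d" "\<lambda>s. poly (lin (x + of_nat s)) u"]
    by (simp add: atLeastLessThanSuc_atLeastAtMost)
  have *: "poly (denom b d) u = pochhammer (u + b $ j) (Suc k) *
      (\<Prod>s\<in>{Suc k..d}. poly (lin (b $ j + of_nat s)) u) *
      ((\<Prod>h\<in>UNIV - {j}. pochhammer (u + b $ h) k) *
       (\<Prod>h\<in>UNIV - {j}. \<Prod>s\<in>{k..d}. poly (lin (b $ h + of_nat s)) u))"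
  proof -
    have "poly (denom b d) u = (\<Prod>s\<in>{0..d}. poly (lin (b $ j + of_nat s)) u) *
        (\<Prod>h\<in>UNIV - {j}. \<Prod>s\<in>{0..d}. poly (lin (b $ h + of_nat s)) u)"
      unfolding denom_def poly_prod by (rule prod.remove) auto
    also have "(\<Prod>s\<in>{0..d}. poly (lin (b $ j + of_nat s)) u) =
        pochhammer (u + b $ j) (Suc k) * (\<Prod>s\<in>{Suc k..d}. poly (lin (b $ j + of_nat s)) u)"
      using assms(1) by (intro split) simp
    also have "(\<Prod>h\<in>UNIV - {j}. \<Prod>s\<in>{0..d}. poly (lin (b $ h + of_nat s)) u) =
        (\<Prod>h\<in>UNIV - {j}. pochhammer (u + b $ h) k * (\<Prod>s\<in>{k..d}. poly (lin (b $ h + of_nat s)) u))"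
      using assms(1) by (intro prod.cong refl split) simp
    finally show ?thesis by (simp only: prod.distrib)
  qed
  have num: "poly (Psi a b d k j) u = (\<Prod>\<rho>\<in>UNIV. pochhammer (u + a $ \<rho>) k) *
      ((\<Prod>s\<in>{Suc k..d}. poly (lin (b $ j + of_nat s)) u) *
       (\<Prod>h\<in>UNIV - {j}. \<Prod>s\<in>{k..d}. poly (lin (b $ h + of_nat s)) u))"
    by (simp only: Psi_def poly_mult poly_prod poch)
  have "d - (d - k) = k" using assms(1) by simp
  then have Phi: "seed_Phi a b d (d - k) j u = (\<Prod>\<rho>\<in>UNIV. pochhammer (u + a $ \<rho>) k) /
      (pochhammer (u + b $ j) (Suc k) * (\<Prod>h\<in>UNIV - {j}. pochhammer (u + b $ h) k))"
    by (simp add: seed_Phi_def)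
  \<comment> \<open>As x / 0 = 0, only the cancelled factors y and z have to be nonzero.\<close>
  have cancel: "y \<noteq> 0 \<Longrightarrow> z \<noteq> 0 \<Longrightarrow> x / (v * w) = x * (y * z) / (v * y * (w * z))"
    for v w x y z :: complex
    by simp
  show ?thesis
    unfolding Phi * num
    by (rule cancel) (use assms(2) in \<open>simp_all only: * mult_eq_0_iff de_Morgan_disj not_False_eq_True\<close>)
qed

text \<open>Positivity of \<open>msize m\<close> matters because \<open>depth\<close> is a truncated
  difference: for m = 0 it would equal \<open>max_entry m\<close>.\<close>

lemma near_diagonal_cases:
  fixes m :: "nat ^ 'q::finite"
  assumes "near_diagonal m" "msize m > 0"
  shows "max_entry m = Suc (depth m)" "m $ j = depth m \<or> m $ j = Suc (depth m)"
    "\<exists>j. m $ j = Suc (depth m)"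
proof -
  have "max_entry m \<in> range (\<lambda>j. m $ j)"
    unfolding max_entry_def by (rule Max_in) auto
  then obtain j0 where j0: "m $ j0 = max_entry m" by auto
  have le: "m $ j \<le> max_entry m" for j
    unfolding max_entry_def by (rule Max_ge) auto
  have "max_entry m > 0"
  proof (rule ccontr)
    assume "\<not> max_entry m > 0"
    then have "m $ j = 0" for j using le[of j] by simp
    with assms(2) show False by (simp add: msize_def)
  qed
  then show max: "max_entry m = Suc (depth m)" by (simp add: depth_def)
  have "\<bar>int (m $ j) - int (m $ j0)\<bar> \<le> 1"
    using assms(1) unfolding near_diagonal_def by blast
  then show "m $ j = depth m \<or> m $ j = Suc (depth m)"
    using le[of j] unfolding j0 max by linarith
  show "\<exists>j. m $ j = Suc (depth m)" using j0 max by auto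
qed

section \<open>Triangularity of the symbol map and the symbol of the seed\<close>

text \<open>Collects the hypotheses on a and b alone, with d in the place of m_* - 1; \<kappa>
  enters only through nodes and operators.\<close>

locale generic_parameters =
  fixes a :: "complex ^ 'r::finite" and b :: "complex ^ 'q::finite" and d :: nat
  assumes rq: "CARD('r) < CARD('q)"
    and b_diff: "\<And>j h. j \<noteq> h \<Longrightarrow> b $ j - b $ h \<notin> \<int>"
    and a_diff: "\<And>\<rho> j. a $ \<rho> - b $ j - of_nat d \<notin> \<int>\<^sub>\<le>\<^sub>0"
begin

lemma pole_eq_iff: "b $ j + of_nat k = b $ h + of_nat l \<longleftrightarrow> j = h \<and> k = l"
proof
  assume eq: "b $ j + of_nat k = b $ h + of_nat l"
  then have "b $ j - b $ h = of_nat l - of_nat k" by (simp add: algebra_simps)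
  then have "j = h" using b_diff[of j h] by auto
  with eq show "j = h \<and> k = l" by simp
qed auto

lemma inj_b: "inj (\<lambda>j. b $ j)"
  by (rule injI, rule ccontr) (use b_diff in force)

text \<open>The poles are distinct, hence simple, and \<delta> is the value of the remaining factors
  of the denominator. As it does not depend on P, relations between residues become relations
  between values.\<close>

lemma residue_denom:
  assumes "k \<le> d"
  obtains \<delta> where "\<delta> \<noteq> 0"
    "\<And>P. residue (\<lambda>u. poly P u / poly (denom b d) u) (- b $ j - of_nat k) =
       poly P (- b $ j - of_nat k) / \<delta>"
proof -
  let ?Q = "(\<Prod>s\<in>{0..d} - {k}. lin (b $ j + of_nat s)) *
      (\<Prod>h\<in>UNIV - {j}. \<Prod>s\<in>{0..d}. lin (b $ h + of_nat s))"
  let ?u = "- b $ j - of_nat k"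
  have "?u + (b $ h + of_nat s) = 0 \<longleftrightarrow> j = h \<and> k = s" for h s
    using pole_eq_iff[of j k h s] by (auto simp: algebra_simps)
  then have nz: "poly ?Q ?u \<noteq> 0"
    by (auto simp: poly_prod)
  have "denom b d = lin (- ?u) * ?Q"
    using denom_split[OF assms, of b j] by (simp add: add.commute)
  then show thesis using that[OF nz] residue_poly_quotient[OF nz] by simp
qed

text \<open>By \<open>poly_Psi_eq_0\<close>, the levels below k and the other components at level k
  drop out.\<close>

lemma poly_symbol_pole:
  assumes "k \<le> d"
  shows "poly (symbol a b d p) (- b $ j - of_nat k) =
    (\<Sum>l\<in>{k<..d}. \<Sum>h\<in>UNIV. p l h * poly (Psi a b d l h) (- b $ j - of_nat k)) +
    p k j * poly (Psi a b d k j) (- b $ j - of_nat k)"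
proof -
  let ?t = "\<lambda>l h. p l h * poly (Psi a b d l h) (- b $ j - of_nat k)"
  have "poly (symbol a b d p) (- b $ j - of_nat k) = (\<Sum>l\<le>d. \<Sum>h\<in>UNIV. ?t l h)"
    by (simp add: symbol_def poly_sum)
  also have "{..d} = {k<..d} \<union> {..k}" using assms by auto
  also have "(\<Sum>l\<in>{k<..d} \<union> {..k}. \<Sum>h\<in>UNIV. ?t l h) =
      (\<Sum>l\<in>{k<..d}. \<Sum>h\<in>UNIV. ?t l h) + (\<Sum>l\<in>{..k}. \<Sum>h\<in>UNIV. ?t l h)"
    by (rule sum.union_disjoint) auto
  also have "(\<Sum>l\<in>{..k}. \<Sum>h\<in>UNIV. ?t l h) = (\<Sum>l\<in>{..k}. if l = k then ?t k j else 0)"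
  proof (intro sum.cong refl)
    fix l assume "l \<in> {..k}"
    show "(\<Sum>h\<in>UNIV. ?t l h) = (if l = k then ?t k j else 0)"
    proof (cases "l = k")
      case True
      have "(\<Sum>h\<in>UNIV. ?t k h) = ?t k j"
        by (subst sum.remove[of _ j]) (auto intro!: sum.neutral simp: poly_Psi_eq_0 assms)
      with True show ?thesis by simp
    next
      case False
      with \<open>l \<in> {..k}\<close> show ?thesis
        by (auto intro!: sum.neutral poly_Psi_eq_0 simp: assms)
    qed
  qed
  finally show ?thesis by simp
qed

lemma poly_symbol_top:
  "poly (symbol a b d p) (- b $ j - of_nat d) = p d j * poly (Psi a b d d j) (- b $ j - of_nat d)"
  by (subst poly_symbol_pole) auto

lemma Psi_pole: "k \<le> d \<Longrightarrow> poly (Psi a b d k j) (- b $ j - of_nat k) \<noteq> 0"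
  using poly_Psi_neq_0 a_diff b_diff by blast

text \<open>Back substitution in the triangular system, from level d downwards; the measure d - k
  makes this an induction.\<close>

lemma symbol_eq_0D:
  assumes "symbol a b d p = 0" "k \<le> d"
  shows "p k j = 0"
  using assms(2)
proof (induction k arbitrary: j rule: measure_induct_rule[of "\<lambda>k. d - k"])
  case (less k)
  have "(\<Sum>l\<in>{k<..d}. \<Sum>h\<in>UNIV. p l h * poly (Psi a b d l h) (- b $ j - of_nat k)) = 0"
    by (intro sum.neutral ballI) (use less in auto)
  then have "p k j * poly (Psi a b d k j) (- b $ j - of_nat k) = 0"
    using poly_symbol_pole[OF less.prems, of p j] assms(1) by simp
  then show ?case using Psi_pole less.prems by auto
qed

text \<open>The q (d + 1) poles are distinct, and both degrees are smaller than their
  number.\<close>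

lemma symbol_eqI:
  assumes "degree P < CARD('q) * Suc d"
    and "\<And>k j. k \<le> d \<Longrightarrow>
      poly (symbol a b d p) (- b $ j - of_nat k) = poly P (- b $ j - of_nat k)"
  shows "symbol a b d p = P"
proof (rule poly_eqI_degree[where A = "(\<lambda>(j, k). - b $ j - of_nat k) ` (UNIV \<times> {..d})"])
  have "inj_on (\<lambda>(j, k). - b $ j - of_nat k :: complex) (UNIV \<times> {..d})"
  proof (rule inj_onI, clarify)
    fix j h k l
    assume "- b $ j - of_nat k = - b $ h - of_nat l"
    then have "b $ j + of_nat k = b $ h + of_nat l" by (simp add: algebra_simps)
    then show "j = h \<and> k = l" by (simp add: pole_eq_iff)
  qed
  then have card: "card ((\<lambda>(j, k). - b $ j - of_nat k :: complex) ` (UNIV \<times> {..d})) = CARD('q) * Suc d"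
    by (simp add: card_image card_cartesian_product)
  show "degree (symbol a b d p) < card ((\<lambda>(j, k). - b $ j - of_nat k) ` (UNIV \<times> {..d}))"
    "degree P < card ((\<lambda>(j, k). - b $ j - of_nat k) ` (UNIV \<times> {..d}))"
    unfolding card by (rule degree_symbol[OF rq], rule assms(1))
qed (use assms(2) in auto)

text \<open>Multiplied by \<delta>, the residue recursion at e = d - k is exactly the triangular
  system of \<open>poly_symbol_pole\<close> with the values of \<open>Rhat\<close> on the right-hand
  side.\<close>

lemma symbol_seed:
  assumes m: "\<And>j. m $ j = d \<or> m $ j = Suc d" "\<exists>j. m $ j = Suc d" and d: "depth m = d"
  shows "symbol a b d (\<lambda>k. seed_coeff a b m \<gamma> (d - k)) = Rhat b m d \<gamma>"
proof (rule symbol_eqI)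
  \<comment> \<open>Some m_j equals d + 1, so fewer than q factors occur; this strictness is needed
    when d = 0.\<close>
  have "degree (Rhat b m d \<gamma>) \<le> card {h. m $ h = d}"
    unfolding Rhat_def by (rule order.trans[OF degree_smult_le]) simp
  also have "\<dots> < CARD('q)"
  proof (rule psubset_card_mono)
    obtain j where "m $ j = Suc d" using m(2) by auto
    then have "j \<notin> {h. m $ h = d}" by simp
    then show "{h. m $ h = d} \<subset> UNIV" by blast
  qed simp
  finally show "degree (Rhat b m d \<gamma>) < CARD('q) * Suc d" by simp
next
  fix k j assume k: "k \<le> d"
  let ?u = "- b $ j - of_nat k"
  let ?s = "\<lambda>k. seed_coeff a b m \<gamma> (d - k)"
  obtain \<delta> where \<delta>: "\<delta> \<noteq> 0" and
    res: "\<And>P. residue (\<lambda>u. poly P u / poly (denom b d) u) ?u = poly P ?u / \<delta>"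
    using residue_denom[OF k, of j] by blast
  \<comment> \<open>A residue depends only on values near the point, so the quotient formulas valid
    off the zeros of \<open>denom\<close> suffice.\<close>
  have ev: "\<forall>\<^sub>F u in at ?u. poly (denom b d) u \<noteq> 0"
    by (rule eventually_poly_neq_0) simp
  have R: "residue (seed_R b m \<gamma>) ?u = poly (Rhat b m d \<gamma>) ?u / \<delta>"
    unfolding res[symmetric]
    by (rule residue_cong[OF eventually_mono[OF ev] refl]) (use m(1) in \<open>simp add: seed_R_eq\<close>)
  have Phi: "residue (seed_Phi a b d (d - l) h) ?u = poly (Psi a b d l h) ?u / \<delta>" if "l \<le> d" for l h
    unfolding res[symmetric]
    by (rule residue_cong[OF eventually_mono[OF ev] refl]) (use that in \<open>simp add: seed_Phi_eq\<close>)
  have u: "- (b $ j) - of_nat d + of_nat (d - k) = ?u"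
    using k by (simp add: of_nat_diff)
  \<comment> \<open>Earlier seed indices \<alpha> < e correspond to higher levels l = d - \<alpha> >
    k.\<close>
  have "(\<Sum>\<alpha>\<in>{..<d - k}. \<Sum>h\<in>UNIV. seed_coeff a b m \<gamma> \<alpha> h * residue (seed_Phi a b d \<alpha> h) ?u) =
     (\<Sum>l\<in>{k<..d}. \<Sum>h\<in>UNIV. ?s l h * residue (seed_Phi a b d (d - l) h) ?u)"
    by (rule sum.reindex_bij_witness[of _ "\<lambda>l. d - l" "\<lambda>l. d - l"]) auto
  also have "\<dots> = (\<Sum>l\<in>{k<..d}. \<Sum>h\<in>UNIV. ?s l h * poly (Psi a b d l h) ?u) / \<delta>"
    by (simp add: Phi sum_divide_distrib)
  finally have "?s k j = (poly (Rhat b m d \<gamma>) ?u / \<delta> -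
      (\<Sum>l\<in>{k<..d}. \<Sum>h\<in>UNIV. ?s l h * poly (Psi a b d l h) ?u) / \<delta>) / (poly (Psi a b d k j) ?u / \<delta>)"
    by (subst seed_coeff.simps) (simp only: Let_def d u R Phi[OF k])
  then have "?s k j * poly (Psi a b d k j) ?u = poly (Rhat b m d \<gamma>) ?u -
      (\<Sum>l\<in>{k<..d}. \<Sum>h\<in>UNIV. ?s l h * poly (Psi a b d l h) ?u)"
    using \<delta> Psi_pole[OF k, of j] by (simp flip: diff_divide_distrib)
  then show "poly (symbol a b d ?s) ?u = poly (Rhat b m d \<gamma>) ?u"
    by (simp add: poly_symbol_pole[OF k])
qed

end

section \<open>Words and repeated letters\<close>

text \<open>The number \<rho>_c inside \<open>word_shift\<close>. It is also the offset l of the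
  node \<kappa>_i + l + 1 that the letter at position c produces.\<close>

definition later_count :: "'p list \<Rightarrow> nat \<Rightarrow> nat" where
  "later_count w c = card {c'. c < c' \<and> c' < length w \<and> w ! c' = w ! c}"

lemma later_count_Cons_Suc: "later_count (x # w) (Suc c) = later_count w c"
proof -
  have "{c'. Suc c < c' \<and> c' < length (x # w) \<and> (x # w) ! c' = (x # w) ! Suc c} =
      Suc ` {c'. c < c' \<and> c' < length w \<and> w ! c' = w ! c}"
  proof (intro set_eqI iffI)
    fix y assume "y \<in> {c'. Suc c < c' \<and> c' < length (x # w) \<and> (x # w) ! c' = (x # w) ! Suc c}"
    then show "y \<in> Suc ` {c'. c < c' \<and> c' < length w \<and> w ! c' = w ! c}"
      by (cases y) auto
  qed auto
  then show ?thesis by (simp add: later_count_def card_image)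
qed

lemma later_count_Cons_0: "later_count (x # w) 0 = count_list w x"
proof -
  have "{c'. 0 < c' \<and> c' < length (x # w) \<and> (x # w) ! c' = (x # w) ! 0} =
      Suc ` {c'. c' < length w \<and> w ! c' = x}"
  proof (intro set_eqI iffI)
    fix y assume "y \<in> {c'. 0 < c' \<and> c' < length (x # w) \<and> (x # w) ! c' = (x # w) ! 0}"
    then show "y \<in> Suc ` {c'. c' < length w \<and> w ! c' = x}"
      by (cases y) auto
  qed auto
  then have "later_count (x # w) 0 = card {c'. c' < length w \<and> w ! c' = x}"
    by (simp add: later_count_def card_image)
  also have "\<dots> = count_list w x"
    by (simp add: count_list_eq_length_filter length_filter_conv_card eq_commute)
  finally show ?thesis .
qed

text \<open>Read from right to left, the occurrences of i have later counts 0, 1, 2, and so on.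
  Prefixing a letter keeps the old counts, and a new i gets the next one.\<close>

lemma ex_later_count:
  assumes "l < count_list w i"
  shows "\<exists>c<length w. w ! c = i \<and> later_count w c = l"
  using assms
proof (induction w)
  case (Cons x w)
  show ?case
  proof (cases "l < count_list w i")
    case True
    then obtain c where "c < length w" "w ! c = i" "later_count w c = l" using Cons.IH by auto
    then show ?thesis by (intro exI[of _ "Suc c"]) (simp add: later_count_Cons_Suc)
  next
    case False
    with Cons.prems have "x = i" "l = count_list w i" by (auto split: if_splits)
    then show ?thesis by (intro exI[of _ 0]) (simp add: later_count_Cons_0)
  qed
qed simp

section \<open>Laurent coefficients of the operators and of the seed\<close>

text \<open>The factor z moves the differential part to index t - 1, which turns the constant 2 of
  the operator into 1.\<close>

lemma fls_nth_raise_op: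
  "fls_nth (raise_op a b \<kappa> i s P $ j) t =
    lam a b j * (\<Sum>h\<in>UNIV. fls_nth (P $ h) t) -
    (of_int t + b $ j + \<kappa> $ i + of_nat s + 1) * fls_nth (P $ j) (t - 1)"
proof -
  have const: "fls_nth (fls_const c * f) t = c * fls_nth f t" "fls_nth (f * fls_const c) t = fls_nth f t * c"
    for c :: complex and f t
    by simp_all
  have X: "fls_nth (fls_X * f) t = fls_nth f (t - 1)" for f :: "complex fls" and t
    by (simp add: fls_X_times_conv_shift)
  have "fls_nth (raise_op a b \<kappa> i s P $ j) t =
      - (of_int (t - 1) * fls_nth (P $ j) (t - 1) + fls_nth (P $ j) (t - 1) * b $ j +
         (\<kappa> $ i + of_nat s + 2) * fls_nth (P $ j) (t - 1)) +
      fls_nth (\<Sum>h\<in>UNIV. P $ h) t * lam a b j"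
    unfolding raise_op_def vec_lambda_beta fls_plus_nth mult_minus_left fls_uminus_nth X const fls_deriv_nth
    by simp
  also have "fls_nth (\<Sum>h\<in>UNIV. P $ h) t = (\<Sum>h\<in>UNIV. fls_nth (P $ h) t)"
    by (simp add: fls_nth_sum)
  finally show ?thesis by (simp add: algebra_simps)
qed

text \<open>The seed occupies the d + 1 exponents from -N to d - N, with index e at exponent d - N -
  e.\<close>

lemma fls_nth_seed:
  fixes n :: "nat ^ 'p::finite"
  shows "fls_nth (seed a b n m \<gamma> $ j) t =
    (if - int (msize n) \<le> t \<and> t \<le> int (depth m) - int (msize n)
     then seed_coeff a b m \<gamma> (nat (int (depth m) - int (msize n) - t)) j else 0)"
proof -
  let ?d = "depth m" and ?N = "msize n"
  have "fls_nth (seed a b n m \<gamma> $ j) t =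
      (\<Sum>e\<le>?d. if t = int ?d - int ?N - int e then seed_coeff a b m \<gamma> e j else 0)"
    unfolding seed_def vec_lambda_beta fls_X_intpow_times_conv_shift fls_shift_nth fls_nth_sum
    by (intro sum.cong refl) auto
  also have "\<dots> = (\<Sum>e\<le>?d. if e = nat (int ?d - int ?N - t) \<and> t \<le> int ?d - int ?N
      then seed_coeff a b m \<gamma> e j else 0)"
    by (intro sum.cong refl if_cong) auto
  also have "\<dots> = (if t \<le> int ?d - int ?N then
      (\<Sum>e\<le>?d. if e = nat (int ?d - int ?N - t) then seed_coeff a b m \<gamma> e j else 0) else 0)"
    by simp
  also have "\<dots> = (if - int ?N \<le> t \<and> t \<le> int ?d - int ?N
     then seed_coeff a b m \<gamma> (nat (int ?d - int ?N - t)) j else 0)"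
    by (auto simp: sum.delta)
  finally show ?thesis .
qed

lemma msize_near_diagonal:
  fixes m :: "nat ^ 'q::finite"
  assumes "\<And>j. m $ j = d \<or> m $ j = Suc d"
  shows "msize m + card {j. m $ j = d} = CARD('q) * Suc d"
proof -
  have "msize m + card {j. m $ j = d} = (\<Sum>j\<in>UNIV. m $ j + (if m $ j = d then 1 else 0))"
    by (simp add: msize_def sum.distrib sum.If_cases)
  also have "\<dots> = (\<Sum>j\<in>(UNIV :: 'q set). Suc d)"
    by (intro sum.cong refl) (use assms in auto)
  finally show ?thesis by simp
qed

section \<open>Root counting and the action of a word\<close>

context generic_parameters
begin

text \<open>Besides the points of S, the symbol vanishes at - b_j - d for every j with m_j = d and
  for j0. These points lie outside S, and altogether there are q (d + 1) roots, more than the degree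
  allows.\<close>

lemma symbol_eq_0I:
  assumes m: "\<And>j. m $ j = d \<or> m $ j = Suc d" and size: "msize m = Suc (card S)"
    and S: "finite S" "\<And>u. u \<in> S \<Longrightarrow> poly (symbol a b d p) u = 0"
      "\<And>u h. u \<in> S \<Longrightarrow> u + b $ h + of_nat d \<noteq> 0"
    and top: "\<And>j. m $ j = d \<Longrightarrow> p d j = 0"
    and j0: "m $ j0 = Suc d" "p d j0 = 0"
  shows "symbol a b d p = 0"
proof (rule poly_eqI_degree)
  define T where "T = (\<lambda>j. - b $ j - of_nat d) ` insert j0 {j. m $ j = d}"
  have "inj_on (\<lambda>j. - b $ j - of_nat d) (insert j0 {j. m $ j = d})"
    using inj_b by (auto simp: inj_on_def)
  then have "card T = Suc (card {j. m $ j = d})"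
    using j0 by (simp add: T_def card_image)
  moreover have "S \<inter> T = {}"
    using S(3) by (fastforce simp: T_def)
  moreover have "finite T" by (simp add: T_def)
  ultimately have card: "card (S \<union> T) = CARD('q) * Suc d"
    using S(1) size msize_near_diagonal[of m d] m by (simp add: card_Un_disjoint)
  show "degree (symbol a b d p) < card (S \<union> T)"
    unfolding card by (rule degree_symbol[OF rq])
  then show "degree (0 :: complex poly) < card (S \<union> T)" by simp
  show "poly (symbol a b d p) u = poly 0 u" if "u \<in> S \<union> T" for u
  proof (cases "u \<in> S")
    case False
    with that obtain j where u: "u = - b $ j - of_nat d" and "j = j0 \<or> m $ j = d"
      by (auto simp: T_def)
    then have "p d j = 0" using top j0 by blast
    then show ?thesis by (simp add: u poly_symbol_top)
  qed (simp add: S(2))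
qed

text \<open>After c letters the exponents fill the window from c - N to c - N + d, and levels are
  counted from its lower end. At c = N the window is 0 to d, so the result is polynomial.\<close>

lemma word_op_invariant:
  fixes w :: "'p::finite list" and n :: "nat ^ 'p" and m :: "nat ^ 'q"
    and \<kappa> :: "complex ^ 'p" and \<gamma> :: complex
  defines "F \<equiv> \<lambda>c. fold (\<lambda>c. raise_op a b \<kappa> (w ! c) (word_shift w c)) [0..<c] (seed a b n m \<gamma>)"
  assumes m: "\<And>j. m $ j = d \<or> m $ j = Suc d" "\<exists>j. m $ j = Suc d" "depth m = d"
    and size: "msize m = Suc (msize n)" and len: "length w = msize n"
    and c: "c \<le> length w"
  shows "(\<forall>j t. t < int c - int (length w) \<or> t > int c - int (length w) + int d \<longrightarrow> fls_nth (F c $ j) t = 0) \<and>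
    symbol a b d (\<lambda>k j. fls_nth (F c $ j) (int c - int (length w) + int k)) =
      Rhat b m d \<gamma> * (\<Prod>c'<c. lin (- (\<kappa> $ (w ! c') + 1 + of_nat (later_count w c'))))"
  using c
proof (induction c)
  case 0
  have "fls_nth (F 0 $ j) (- int (msize n) + int k) = seed_coeff a b m \<gamma> (d - k) j" if "k \<le> d" for k j
  proof -
    have "nat (int d - int (msize n) - (- int (msize n) + int k)) = d - k" using that by simp
    then show ?thesis using that by (simp add: F_def fls_nth_seed m(3))
  qed
  then have "symbol a b d (\<lambda>k j. fls_nth (F 0 $ j) (- int (msize n) + int k)) =
      symbol a b d (\<lambda>k. seed_coeff a b m \<gamma> (d - k))"
    by (simp add: symbol_def)
  also have "\<dots> = Rhat b m d \<gamma>" by (rule symbol_seed) (use m in auto)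
  finally show ?case by (auto simp: F_def fls_nth_seed m(3) len)
next
  case (Suc c)
  let ?N = "length w"
  let ?x = "\<kappa> $ (w ! c) + 1 + of_nat (later_count w c)"
  define p where "p = (\<lambda>k j. fls_nth (F c $ j) (int c - int ?N + int k))"
  define p' where "p' = (\<lambda>k j. fls_nth (F (Suc c) $ j) (int (Suc c) - int ?N + int k))"
  have cN: "c < ?N" using Suc.prems by simp
  have supp: "fls_nth (F c $ j) t = 0" if "t < int c - int ?N \<or> t > int c - int ?N + int d" for j t
    using Suc that by auto
  have sym: "symbol a b d p =
      Rhat b m d \<gamma> * (\<Prod>c'<c. lin (- (\<kappa> $ (w ! c') + 1 + of_nat (later_count w c'))))"
    using Suc by (simp add: p_def)
  have F_Suc: "F (Suc c) = raise_op a b \<kappa> (w ! c) (word_shift w c) (F c)"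
    by (simp add: F_def)
  have sum0: "(\<Sum>h\<in>UNIV. p 0 h) = 0"
  proof -
    have "degree (symbol a b d p) \<le> card {h. m $ h = d} + c"
    proof -
      have "degree (Rhat b m d \<gamma>) \<le> card {h. m $ h = d}"
        unfolding Rhat_def by (rule order.trans[OF degree_smult_le]) simp
      then show ?thesis
        unfolding sym by (intro order.trans[OF degree_mult_le] add_mono) simp_all
    qed
    \<comment> \<open>The right side is card {h. m_h = d} + N, because |m| = N + 1; and c <
      N.\<close>
    also have "\<dots> < CARD('q) * Suc d - 1"
      using msize_near_diagonal[of m d] m(1) size len cN by simp
    finally have "coeff (symbol a b d p) (CARD('q) * Suc d - 1) = 0"
      by (rule coeff_eq_0)
    then show ?thesis using coeff_symbol_top[OF rq] by metis
  qed
  \<comment> \<open>The part N - 1 - c of the shift cancels the lower end c + 1 - N of the new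
    window, leaving \<open>?x\<close>.\<close>
  have shift: "of_nat (word_shift w c) = of_nat ?N - 1 - of_nat c + (of_nat (later_count w c) :: complex)"
    using cN by (simp add: word_shift_def later_count_def of_nat_diff)
  have step: "p' k j = lam a b j * (\<Sum>h\<in>UNIV. p (Suc k) h) - (of_nat k + b $ j + ?x) * p k j" for k j
  proof -
    have "int (Suc c) - int ?N + int k = int c - int ?N + int (Suc k)"
      "int (Suc c) - int ?N + int k - 1 = int c - int ?N + int k" by simp_all
    then show ?thesis
      unfolding p'_def p_def F_Suc fls_nth_raise_op shift by (simp add: algebra_simps)
  qed
  have "symbol a b d p' = lin (- ?x) * symbol a b d p"
  proof (rule symbol_step[where p = p, OF rq inj_b sum0])
    show "p (Suc d) h = 0" for h unfolding p_def by (rule supp) simp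
  qed (rule step)
  then have "symbol a b d p' =
      Rhat b m d \<gamma> * (\<Prod>c'<Suc c. lin (- (\<kappa> $ (w ! c') + 1 + of_nat (later_count w c'))))"
    by (simp add: sym mult_ac)
  moreover have "fls_nth (F (Suc c) $ j) t = 0"
    if t: "t < int (Suc c) - int ?N \<or> t > int (Suc c) - int ?N + int d" for j t
  proof -
    have 1: "fls_nth (F c $ j) (t - 1) = 0" using t by (intro supp) auto
    \<comment> \<open>Only t = c - N lies in the old window but outside the new one; there the sum
      is the vanishing one of \<open>sum0\<close>.\<close>
    have 2: "(\<Sum>h\<in>UNIV. fls_nth (F c $ h) t) = 0"
    proof (cases "t = int c - int ?N")
      case True
      then show ?thesis using sum0 by (simp add: p_def)
    next
      case False
      then show ?thesis using t by (intro sum.neutral ballI supp) auto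
    qed
    show ?thesis unfolding F_Suc fls_nth_raise_op 1 2 by simp
  qed
  ultimately show ?case by (auto simp: p'_def)
qed

end

section \<open>Integrals over the unit circle and moments of the weights\<close>

lemma has_contour_integral_powi_unit_circle:
  "((\<lambda>z. z powi n) has_contour_integral (if n = - 1 then 2 * of_real pi * \<i> else 0)) (circlepath 0 1)"
proof (cases "n = - 1")
  case True
  have "((\<lambda>z. 1 / (z - 0)) has_contour_integral 2 * of_real pi * \<i> * 1) (circlepath 0 1)"
    using Cauchy_integral_circlepath_simple[of "\<lambda>_. 1" 0 1 0] by simp
  with True show ?thesis by (simp add: power_int_minus field_simps)
next
  case False
  define f where "f = (\<lambda>z::complex. z powi (n + 1) / of_int (n + 1))"
  have "((\<lambda>z. z powi n) has_contour_integral
      f (pathfinish (circlepath 0 1)) - f (pathstart (circlepath 0 1))) (circlepath 0 1)"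
  proof (rule contour_integral_primitive[where S = "- {0}"])
    fix z :: complex assume "z \<in> - {0}"
    moreover have "of_int n + (1 :: complex) \<noteq> 0"
      using False by (metis add_eq_0_iff2 of_int_1 of_int_eq_iff of_int_minus)
    ultimately show "(f has_field_derivative z powi n) (at z within - {0})"
      unfolding f_def by (auto intro!: derivative_eq_intros)
  qed auto
  with False show ?thesis by simp
qed

text \<open>Absolute summability gives uniform convergence on the circle, hence termwise
  integration; only the power z^(-1), at k = l, contributes.\<close>

lemma contour_integral_laurent_tail:
  assumes "summable (\<lambda>k. norm (f k))"
  shows "((\<lambda>z. z ^ l * (\<Sum>k. f k * z powi (- int k - 1))) has_contour_integral 2 * of_real pi * \<i> * f l)
    (circlepath 0 1)"
proof -
  let ?t = "\<lambda>k z. z ^ l * (f k * z powi (- int k - 1))"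
  let ?I = "\<lambda>n. \<Sum>k<n. if k = l then 2 * of_real pi * \<i> * f l else 0"
  have summand: "(?t k has_contour_integral (if k = l then 2 * of_real pi * \<i> * f l else 0)) (circlepath 0 1)" for k
  proof -
    have "((\<lambda>z. f k * z powi (int l - int k - 1)) has_contour_integral
        f k * (if int l - int k - 1 = - 1 then 2 * of_real pi * \<i> else 0)) (circlepath 0 1)"
      by (intro has_contour_integral_lmul has_contour_integral_powi_unit_circle)
    then have "((\<lambda>z. f k * z powi (int l - int k - 1)) has_contour_integral
        (if k = l then 2 * of_real pi * \<i> * f l else 0)) (circlepath 0 1)"
      by (auto split: if_splits simp: mult_ac)
    then show ?thesis
    proof (rule has_contour_integral_eq)
      fix z assume "z \<in> path_image (circlepath 0 1)"
      then have "z \<noteq> 0" by auto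
      then show "f k * z powi (int l - int k - 1) = ?t k z"
        using power_int_add[of z "int l" "- int k - 1"] by (simp add: mult_ac add_diff_eq)
    qed
  qed
  have partial: "((\<lambda>z. \<Sum>k<n. ?t k z) has_contour_integral ?I n) (circlepath 0 1)" for n
    by (intro has_contour_integral_sum summand) auto
  have unif: "uniform_limit (sphere 0 1) (\<lambda>n z. \<Sum>k<n. ?t k z) (\<lambda>z. \<Sum>k. ?t k z) sequentially"
  proof (rule Weierstrass_m_test)
    show "norm (?t k z) \<le> norm (f k)" if "z \<in> sphere 0 1" for k z
      using that by (simp add: norm_mult norm_power norm_power_int)
  qed (rule assms)
  have ev: "\<forall>\<^sub>F n in sequentially. (\<lambda>z. \<Sum>k<n. ?t k z) contour_integrable_on circlepath 0 1"
    by (intro always_eventually allI has_contour_integral_integrable[OF partial])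
  have int: "(\<lambda>z. \<Sum>k. ?t k z) contour_integrable_on circlepath 0 1"
    and lim: "(\<lambda>n. contour_integral (circlepath 0 1) (\<lambda>z. \<Sum>k<n. ?t k z)) \<longlonglongrightarrow>
      contour_integral (circlepath 0 1) (\<lambda>z. \<Sum>k. ?t k z)"
    using contour_integral_uniform_limit_circlepath[OF ev unif] by auto
  have "(\<lambda>n. contour_integral (circlepath 0 1) (\<lambda>z. \<Sum>k<n. ?t k z)) \<longlonglongrightarrow> 2 * of_real pi * \<i> * f l"
  proof (rule tendsto_eventually)
    show "\<forall>\<^sub>F n in sequentially. contour_integral (circlepath 0 1) (\<lambda>z. \<Sum>k<n. ?t k z) = 2 * of_real pi * \<i> * f l"
      using eventually_gt_at_top[of l]
      by eventually_elim (simp add: contour_integral_unique[OF partial])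
  qed
  with lim have "contour_integral (circlepath 0 1) (\<lambda>z. \<Sum>k. ?t k z) = 2 * of_real pi * \<i> * f l"
    by (rule LIMSEQ_unique)
  then have "((\<lambda>z. \<Sum>k. ?t k z) has_contour_integral 2 * of_real pi * \<i> * f l) (circlepath 0 1)"
    using has_contour_integral_integral[OF int] by simp
  then show ?thesis
  proof (rule has_contour_integral_eq)
    fix z assume "z \<in> path_image (circlepath 0 1)"
    then have z: "norm z = 1" by (auto simp: dist_norm)
    have "summable (\<lambda>k. f k * z powi (- int k - 1))"
      by (rule summable_norm_cancel) (use assms z in \<open>simp add: norm_mult norm_power_int\<close>)
    then show "(\<Sum>k. ?t k z) = z ^ l * (\<Sum>k. f k * z powi (- int k - 1))"
      by (rule suminf_mult)
  qed
qed

text \<open>Ratio test: the quotient g of consecutive terms decays like k^(-(q - r)).\<close>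

lemma summable_pochhammer_quotient:
  fixes \<alpha> :: "'r::finite \<Rightarrow> complex" and \<beta> :: "'q::finite \<Rightarrow> complex"
  assumes "CARD('r) < CARD('q)" and \<beta>: "\<And>h. \<beta> h \<notin> \<int>\<^sub>\<le>\<^sub>0"
  shows "summable (\<lambda>k. norm ((\<Prod>\<rho>\<in>UNIV. pochhammer (\<alpha> \<rho>) k) / (\<Prod>h\<in>UNIV. pochhammer (\<beta> h) k)))"
    (is "summable (\<lambda>k. norm (?f k))")
proof -
  define g where "g k = (\<Prod>\<rho>\<in>UNIV. \<alpha> \<rho> + of_nat k) / (\<Prod>h\<in>UNIV. \<beta> h + of_nat k)" for k
  have f_Suc: "?f (Suc k) = g k * ?f k" for k
    by (simp add: g_def pochhammer_Suc prod.distrib mult_ac)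
  have one: "(\<lambda>k. x / of_nat k + 1) \<longlonglongrightarrow> 1" for x :: complex
    using tendsto_add[OF lim_const_over_n[of x] tendsto_const[of 1]] by simp
  define e where "e = CARD('q) - CARD('r)"
  have e: "CARD('q) = CARD('r) + e" "e > 0" using assms(1) by (auto simp: e_def)
  \<comment> \<open>Numerator and denominator of g are divided by k^r and k^q, which leaves (1/k)^e
    with e > 0.\<close>
  have "(\<lambda>k. (\<Prod>\<rho>\<in>UNIV. \<alpha> \<rho> / of_nat k + 1) / (\<Prod>h\<in>UNIV. \<beta> h / of_nat k + 1) * (1 / of_nat k) ^ e)
      \<longlonglongrightarrow> (\<Prod>\<rho>\<in>(UNIV :: 'r set). 1) / (\<Prod>h\<in>(UNIV :: 'q set). 1) * 0 ^ e"
    by (intro tendsto_intros one lim_const_over_n) auto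
  then have "(\<lambda>k. (\<Prod>\<rho>\<in>UNIV. \<alpha> \<rho> / of_nat k + 1) / (\<Prod>h\<in>UNIV. \<beta> h / of_nat k + 1) * (1 / of_nat k) ^ e)
      \<longlonglongrightarrow> 0"
    using e(2) by (simp add: power_0_left)
  then have "g \<longlonglongrightarrow> 0"
  proof (rule Lim_transform_eventually)
    show "\<forall>\<^sub>F k in sequentially. (\<Prod>\<rho>\<in>UNIV. \<alpha> \<rho> / of_nat k + 1) / (\<Prod>h\<in>UNIV. \<beta> h / of_nat k + 1) *
        (1 / of_nat k) ^ e = g k"
      using eventually_gt_at_top[of 0]
    proof eventually_elim
      case (elim k)
      have "x / of_nat k + 1 = (x + of_nat k) / of_nat k" for x :: complex
        using elim by (simp add: add_divide_distrib)
      then show ?case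
        using elim by (simp add: g_def e(1) prod_dividef power_add power_divide)
    qed
  qed
  then have "\<forall>\<^sub>F k in sequentially. norm (g k) < 1 / 2"
    by (intro order_tendstoD(2)[where y = 0] tendsto_norm_zero) auto
  then obtain N where N: "\<And>k. k \<ge> N \<Longrightarrow> norm (g k) < 1 / 2"
    by (auto simp: eventually_sequentially)
  show ?thesis
  proof (rule summable_ratio_test[where c = "1 / 2" and N = N])
    fix k assume "k \<ge> N"
    have "norm (?f (Suc k)) = norm (g k) * norm (?f k)"
      unfolding f_Suc by (rule norm_mult)
    also have "\<dots> \<le> 1 / 2 * norm (?f k)"
      by (rule mult_right_mono) (use N[OF \<open>k \<ge> N\<close>] in auto)
    finally show "norm (norm (?f (Suc k))) \<le> 1 / 2 * norm (norm (?f k))" by simp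
  qed simp
qed

definition weight_coeff ::
  "complex ^ 'r::finite \<Rightarrow> complex ^ 'q::finite \<Rightarrow> complex \<Rightarrow> 'q \<Rightarrow> nat \<Rightarrow> complex" where
  "weight_coeff a b t j k = (\<Prod>\<rho>\<in>UNIV. Gamma (of_nat k + t + a $ \<rho> + 1)) /
     (\<Prod>h\<in>UNIV. Gamma (of_nat k + t + b $ h + axis j 1 $ h + 1))"

lemma weight_eq: "weight a b \<kappa> j i z = (\<Sum>k. weight_coeff a b (\<kappa> $ i) j k * z powi (- int k - 1))"
  by (simp add: weight_def weight_coeff_def)

lemma add_nat_notin_nonpos_Ints: "(x :: complex) \<notin> \<int>\<^sub>\<le>\<^sub>0 \<Longrightarrow> x + of_nat k \<notin> \<int>\<^sub>\<le>\<^sub>0"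
  using nonpos_Ints_diff_Nats[of "x + of_nat k" "of_nat k"] by auto

lemma Gamma_add_nat:
  assumes "(z :: complex) \<notin> \<int>\<^sub>\<le>\<^sub>0"
  shows "Gamma (z + of_nat k) = Gamma z * pochhammer z k"
  using Gamma_nonzero[OF assms] by (simp add: pochhammer_Gamma assms)

lemma summable_weight_coeff:
  fixes a :: "complex ^ 'r::finite" and b :: "complex ^ 'q::finite"
  assumes "CARD('r) < CARD('q)" "\<And>\<rho>. t + a $ \<rho> + 1 \<notin> \<int>\<^sub>\<le>\<^sub>0" "\<And>h. t + b $ h + 1 \<notin> \<int>\<^sub>\<le>\<^sub>0"
  shows "summable (\<lambda>k. norm (weight_coeff a b t j k))"
proof -
  define \<alpha> where "\<alpha> \<rho> = t + a $ \<rho> + 1" for \<rho>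
  define \<beta> where "\<beta> h = t + b $ h + 1 + axis j 1 $ h" for h
  have \<beta>: "\<beta> h \<notin> \<int>\<^sub>\<le>\<^sub>0" for h
    using assms(3)[of h] add_nat_notin_nonpos_Ints[OF assms(3)[of h], of 1]
    by (auto simp: \<beta>_def axis_def)
  have \<alpha>: "\<alpha> \<rho> \<notin> \<int>\<^sub>\<le>\<^sub>0" for \<rho> using assms(2) by (simp add: \<alpha>_def)
  have "weight_coeff a b t j k = (\<Prod>\<rho>\<in>UNIV. Gamma (\<alpha> \<rho>)) / (\<Prod>h\<in>UNIV. Gamma (\<beta> h)) *
      ((\<Prod>\<rho>\<in>UNIV. pochhammer (\<alpha> \<rho>) k) / (\<Prod>h\<in>UNIV. pochhammer (\<beta> h) k))" for k
  proof -
    have "Gamma (of_nat k + t + a $ \<rho> + 1) = Gamma (\<alpha> \<rho>) * pochhammer (\<alpha> \<rho>) k" for \<rho>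
      using Gamma_add_nat[OF \<alpha>[of \<rho>], of k] by (simp add: \<alpha>_def add_ac)
    moreover have "Gamma (of_nat k + t + b $ h + axis j 1 $ h + 1) = Gamma (\<beta> h) * pochhammer (\<beta> h) k" for h
      using Gamma_add_nat[OF \<beta>[of h], of k] by (simp add: \<beta>_def add_ac)
    ultimately show ?thesis by (simp add: weight_coeff_def prod.distrib)
  qed
  then have "(\<lambda>k. norm (weight_coeff a b t j k)) = (\<lambda>k. norm ((\<Prod>\<rho>\<in>UNIV. Gamma (\<alpha> \<rho>)) / (\<Prod>h\<in>UNIV. Gamma (\<beta> h))) *
      norm ((\<Prod>\<rho>\<in>UNIV. pochhammer (\<alpha> \<rho>) k) / (\<Prod>h\<in>UNIV. pochhammer (\<beta> h) k)))"
    by (simp only: norm_mult)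
  then show ?thesis
    by (simp only: summable_mult summable_pochhammer_quotient[OF assms(1) \<beta>])
qed

text \<open>All Gamma values are expanded around the node u. The extra unit in the j-th Gamma of the
  denominator becomes the longer Pochhammer symbol at j in \<open>seed_Phi\<close>.\<close>

lemma weight_coeff_shift:
  fixes a :: "complex ^ 'r::finite" and b :: "complex ^ 'q::finite"
  assumes u: "u = t + of_nat l + 1" and "k \<le> d"
    and a: "\<And>\<rho>. u + a $ \<rho> \<notin> \<int>\<^sub>\<le>\<^sub>0" and b: "\<And>h. u + b $ h \<notin> \<int>\<^sub>\<le>\<^sub>0"
  shows "weight_coeff a b t j (l + k) =
    (\<Prod>\<rho>\<in>UNIV. Gamma (u + a $ \<rho>)) / (\<Prod>h\<in>UNIV. Gamma (u + b $ h)) *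
    seed_Phi a b d (d - k) j u"
proof -
  have num: "Gamma (of_nat (l + k) + t + a $ \<rho> + 1) = Gamma (u + a $ \<rho>) * pochhammer (u + a $ \<rho>) k" for \<rho>
    using Gamma_add_nat[OF a[of \<rho>], of k] by (simp add: u add_ac)
  have "(\<Prod>h\<in>UNIV. Gamma (of_nat (l + k) + t + b $ h + axis j 1 $ h + 1)) =
      (\<Prod>h\<in>UNIV. Gamma (u + b $ h) * pochhammer (u + b $ h) (if h = j then Suc k else k))"
  proof (intro prod.cong refl)
    fix h
    show "Gamma (of_nat (l + k) + t + b $ h + axis j 1 $ h + 1) =
        Gamma (u + b $ h) * pochhammer (u + b $ h) (if h = j then Suc k else k)"
      using Gamma_add_nat[OF b[of h], of k] Gamma_add_nat[OF b[of h], of "Suc k"]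
      by (auto simp: u add_ac axis_def)
  qed
  also have "\<dots> = (\<Prod>h\<in>UNIV. Gamma (u + b $ h)) *
      (pochhammer (u + b $ j) (Suc k) * (\<Prod>h\<in>UNIV - {j}. pochhammer (u + b $ h) k))"
    unfolding prod.distrib by (subst (2) prod.remove[of UNIV j]) (auto intro!: arg_cong2[of _ _ _ _ "(*)"] prod.cong)
  finally show ?thesis
    unfolding weight_coeff_def num using assms(2) by (simp add: prod.distrib seed_Phi_def)
qed

text \<open>The l-th integral is a finite combination of the moments l + k. It equals the symbol at
  u times the Gamma quotient \<open>?K\<close> divided by \<open>denom b d\<close> at u, and
  admissibility makes this factor finite and nonzero.\<close>

lemma orthogonality_iff:
  fixes a :: "complex ^ 'r::finite" and b :: "complex ^ 'q::finite"
  assumes rq: "CARD('r) < CARD('q)"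
    and a: "\<And>\<rho>. \<kappa> $ i + a $ \<rho> + 1 \<notin> \<int>\<^sub>\<le>\<^sub>0" and b: "\<And>h. \<kappa> $ i + b $ h + 1 \<notin> \<int>\<^sub>\<le>\<^sub>0"
    and deg: "\<And>j. degree (B $ j) \<le> d"
    and u: "u = \<kappa> $ i + of_nat l + 1"
  shows "(\<Sum>j\<in>UNIV. contour_integral (circlepath 0 1)
      (\<lambda>z. z ^ l * poly (B $ j) z * weight a b \<kappa> j i z / (2 * of_real pi * \<i>))) = 0 \<longleftrightarrow>
    poly (symbol a b d (\<lambda>k j. coeff (B $ j) k)) u = 0"
proof -
  let ?K = "(\<Prod>\<rho>\<in>UNIV. Gamma (u + a $ \<rho>)) / (\<Prod>h\<in>UNIV. Gamma (u + b $ h))"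
  have a': "u + a $ \<rho> \<notin> \<int>\<^sub>\<le>\<^sub>0" for \<rho>
    using add_nat_notin_nonpos_Ints[OF a[of \<rho>], of l] by (simp add: u add_ac)
  have b': "u + b $ h \<notin> \<int>\<^sub>\<le>\<^sub>0" for h
    using add_nat_notin_nonpos_Ints[OF b[of h], of l] by (simp add: u add_ac)
  have denom: "poly (denom b d) u \<noteq> 0"
  proof -
    have "u + (b $ h + of_nat s) \<noteq> 0" for h s
      using add_nat_notin_nonpos_Ints[OF b'[of h], of s] by (auto simp: add_ac)
    then show ?thesis by (auto simp: denom_def poly_prod)
  qed
  have "contour_integral (circlepath 0 1)
      (\<lambda>z. z ^ l * poly (B $ j) z * weight a b \<kappa> j i z / (2 * of_real pi * \<i>)) =
      (\<Sum>k\<le>d. coeff (B $ j) k * weight_coeff a b (\<kappa> $ i) j (l + k))" for j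
  proof -
    let ?W = "\<lambda>z. \<Sum>k. weight_coeff a b (\<kappa> $ i) j k * z powi (- int k - 1)"
    have "((\<lambda>z. \<Sum>k\<le>d. coeff (B $ j) k / (2 * of_real pi * \<i>) * (z ^ (l + k) * ?W z)) has_contour_integral
        (\<Sum>k\<le>d. coeff (B $ j) k / (2 * of_real pi * \<i>) *
           (2 * of_real pi * \<i> * weight_coeff a b (\<kappa> $ i) j (l + k)))) (circlepath 0 1)"
      by (intro has_contour_integral_sum has_contour_integral_lmul contour_integral_laurent_tail
            summable_weight_coeff rq a b) simp
    moreover have "(\<Sum>k\<le>d. coeff (B $ j) k / (2 * of_real pi * \<i>) * (z ^ (l + k) * ?W z)) =
        z ^ l * poly (B $ j) z * weight a b \<kappa> j i z / (2 * of_real pi * \<i>)" for z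
    proof -
      have "poly (B $ j) z = (\<Sum>k\<le>d. coeff (B $ j) k * z ^ k)"
        by (subst poly_as_sum_of_monoms'[OF deg, symmetric]) (simp add: poly_sum poly_monom)
      then show ?thesis
        by (simp add: weight_eq sum_distrib_left sum_distrib_right sum_divide_distrib power_add mult_ac)
    qed
    moreover have "x / (2 * of_real pi * \<i>) * (2 * of_real pi * \<i> * y) = x * y" for x y
      by (simp add: field_simps)
    ultimately show ?thesis
      by (simp only: contour_integral_unique)
  qed
  then have "(\<Sum>j\<in>UNIV. contour_integral (circlepath 0 1)
      (\<lambda>z. z ^ l * poly (B $ j) z * weight a b \<kappa> j i z / (2 * of_real pi * \<i>))) =
      (\<Sum>j\<in>UNIV. \<Sum>k\<le>d. coeff (B $ j) k * weight_coeff a b (\<kappa> $ i) j (l + k))"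
    by simp
  also have "\<dots> = (\<Sum>k\<le>d. \<Sum>j\<in>UNIV. coeff (B $ j) k * weight_coeff a b (\<kappa> $ i) j (l + k))"
    by (rule sum.swap)
  also have "\<dots> = (\<Sum>k\<le>d. \<Sum>j\<in>UNIV. ?K * (coeff (B $ j) k * poly (Psi a b d k j) u / poly (denom b d) u))"
  proof (intro sum.cong refl)
    fix k j assume "k \<in> {..d}"
    then have "k \<le> d" by simp
    then show "coeff (B $ j) k * weight_coeff a b (\<kappa> $ i) j (l + k) =
        ?K * (coeff (B $ j) k * poly (Psi a b d k j) u / poly (denom b d) u)"
      by (simp add: weight_coeff_shift[OF u _ a' b'] seed_Phi_eq denom)
  qed
  also have "\<dots> = ?K * (poly (symbol a b d (\<lambda>k j. coeff (B $ j) k)) u / poly (denom b d) u)"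
    by (simp add: symbol_def poly_sum sum_distrib_left sum_divide_distrib)
  finally show ?thesis
    using Gamma_nonzero[OF a'] Gamma_nonzero[OF b'] denom by simp
qed

section \<open>Nodes and the description of B-vectors by symbols\<close>

lemma symbol_smult: "symbol a b d (\<lambda>k j. c * p k j) = smult c (symbol a b d p)"
  by (simp add: symbol_def smult_sum_right)

lemma symbol_diff: "symbol a b d (\<lambda>k j. p k j - p' k j) = symbol a b d p - symbol a b d p'"
  by (simp add: symbol_def smult_diff_left sum_subtractf)

definition nodes :: "complex ^ 'p::finite \<Rightarrow> nat ^ 'p \<Rightarrow> complex set" where
  "nodes \<kappa> n = (\<Union>i. (\<lambda>l. \<kappa> $ i + of_nat l + 1) ` {..<n $ i})"

lemma finite_nodes [simp]: "finite (nodes \<kappa> n)"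
  by (simp add: nodes_def)

lemma card_nodes:
  fixes \<kappa> :: "complex ^ 'p::finite"
  assumes "\<And>i h. i \<noteq> h \<Longrightarrow> \<kappa> $ i - \<kappa> $ h \<notin> \<int>"
  shows "card (nodes \<kappa> n) = msize n"
proof -
  have "card (nodes \<kappa> n) = (\<Sum>i\<in>UNIV. card ((\<lambda>l. \<kappa> $ i + of_nat l + 1) ` {..<n $ i}))"
    unfolding nodes_def
  proof (rule card_UN_disjoint; safe?)
    fix i h x l l' assume ih: "i \<noteq> h" and "\<kappa> $ i + of_nat l + 1 = \<kappa> $ h + of_nat l' + (1 :: complex)"
    then have "\<kappa> $ i - \<kappa> $ h = of_nat l' - of_nat l" by (simp add: algebra_simps)
    with assms[OF ih] show "\<kappa> $ i + of_nat l + 1 \<in> {}" by simp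
  qed auto
  also have "\<dots> = (\<Sum>i\<in>UNIV. n $ i)"
    by (intro sum.cong refl) (simp add: card_image inj_on_def)
  finally show ?thesis by (simp add: msize_def)
qed

text \<open>Keeps the nodes apart from the roots - b_j - d that the degree bounds supply.\<close>

lemma nodes_avoid_poles:
  assumes "\<And>i j. \<kappa> $ i + b $ j + 1 \<notin> \<int>\<^sub>\<le>\<^sub>0" "u \<in> nodes \<kappa> n"
  shows "u + b $ j + of_nat s \<noteq> 0"
proof
  assume eq: "u + b $ j + of_nat s = 0"
  obtain i l where "u = \<kappa> $ i + of_nat l + 1" using assms(2) by (auto simp: nodes_def)
  then have "\<kappa> $ i + b $ j + 1 + of_nat (l + s) = 0"
    using eq by (simp add: algebra_simps)
  then show False using add_nat_notin_nonpos_Ints[OF assms(1)[of i j], of "l + s"] by simp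
qed

text \<open>Replaces the integrals by zeros of the symbol and the individual degree bounds by the
  common bound d with a condition on the top coefficient, the form that \<open>symbol_eq_0I\<close>
  needs.\<close>

lemma is_B_vector_iff:
  fixes a :: "complex ^ 'r::finite" and b :: "complex ^ 'q::finite" and \<kappa> :: "complex ^ 'p::finite"
  assumes rq: "CARD('r) < CARD('q)"
    and a: "\<And>i \<rho>. \<kappa> $ i + a $ \<rho> + 1 \<notin> \<int>\<^sub>\<le>\<^sub>0" and b: "\<And>i h. \<kappa> $ i + b $ h + 1 \<notin> \<int>\<^sub>\<le>\<^sub>0"
    and m: "\<And>j. m $ j = d \<or> m $ j = Suc d"
  shows "is_B_vector a b \<kappa> n m B \<longleftrightarrow> B \<noteq> 0 \<and>
    (\<forall>j. degree (B $ j) \<le> d \<and> (m $ j = d \<longrightarrow> coeff (B $ j) d = 0)) \<and>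
    (\<forall>u\<in>nodes \<kappa> n. poly (symbol a b d (\<lambda>k j. coeff (B $ j) k)) u = 0)"
proof -
  \<comment> \<open>For d = 0 and m_j = 0 the right side forces a constant with zero coefficient, so
    the zero polynomial.\<close>
  have deg: "B $ j = 0 \<or> degree (B $ j) < m $ j \<longleftrightarrow>
      degree (B $ j) \<le> d \<and> (m $ j = d \<longrightarrow> coeff (B $ j) d = 0)" for j
  proof -
    have "B $ j = 0" if "degree (B $ j) = d" "coeff (B $ j) d = 0"
      using that by (metis leading_coeff_0_iff)
    then show ?thesis using m[of j] by (auto simp: coeff_eq_0 less_Suc_eq_le le_less)
  qed
  have orth: "(\<forall>i l. l < n $ i \<longrightarrow>
        (\<Sum>j\<in>UNIV. contour_integral (circlepath 0 1)
           (\<lambda>z. z ^ l * poly (B $ j) z * weight a b \<kappa> j i z / (2 * of_real pi * \<i>))) = 0) \<longleftrightarrow>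
      (\<forall>u\<in>nodes \<kappa> n. poly (symbol a b d (\<lambda>k j. coeff (B $ j) k)) u = 0)"
    if "\<And>j. degree (B $ j) \<le> d"
    using orthogonality_iff[where \<kappa> = \<kappa>, OF rq a b that refl] by (auto simp: nodes_def)
  show ?thesis
    unfolding is_B_vector_def deg using orth by blast
qed

section \<open>Existence, proportionality and monic normalization\<close>

theorem theorem5p9:
  fixes a :: "complex ^ 'r::finite"
    and b :: "complex ^ 'q::finite"
    and \<kappa> :: "complex ^ 'p::finite"
    and n :: "nat ^ 'p"
    and m :: "nat ^ 'q"
    and \<gamma> :: complex
    and w :: "'p list"
  assumes "CARD('r) < CARD('q)"
    and "regular b \<kappa>"
    and "admissible a b \<kappa> m"
    and "msize m = msize n + 1"
    and "near_diagonal m"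
    and "\<gamma> \<noteq> 0"
    and "length w = msize n"
    and "\<And>i. count_list w i = n $ i"
  shows "(\<exists>B. is_B_vector a b \<kappa> n m B) \<and>
    (\<forall>B. is_B_vector a b \<kappa> n m B \<longrightarrow>
      (\<exists>c. c \<noteq> 0 \<and>
        (\<forall>j. laurent_of_polys B $ j =
               fls_const c * word_op a b \<kappa> w (seed a b n m \<gamma>) $ j))) \<and>
    (\<forall>j. m $ j = max_entry m \<longrightarrow>
      (\<exists>!B. is_B_vector a b \<kappa> n m B \<and> lead_coeff (B $ j) = 1))"
proof -
  define d where "d = depth m"
  have "msize m > 0" using assms(4) by simp
  note nd = near_diagonal_cases[OF assms(5) this, folded d_def]
  have \<kappa>a: "\<kappa> $ i + a $ \<rho> + 1 \<notin> \<int>\<^sub>\<le>\<^sub>0" and \<kappa>b: "\<kappa> $ i + b $ j + 1 \<notin> \<int>\<^sub>\<le>\<^sub>0" for i j \<rho>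
    using assms(3) unfolding admissible_def by blast+
  have \<kappa>: "i \<noteq> h \<Longrightarrow> \<kappa> $ i - \<kappa> $ h \<notin> \<int>" for i h
    using assms(2) unfolding regular_def by blast
  interpret generic_parameters a b d
  proof
    show "j \<noteq> h \<Longrightarrow> b $ j - b $ h \<notin> \<int>" for j h
      using assms(2) unfolding regular_def by blast
    have "a $ \<rho> - b $ j - (of_nat (max_entry m) - 1) \<notin> \<int>\<^sub>\<le>\<^sub>0" for \<rho> j
      using assms(3) unfolding admissible_def by blast
    then show "a $ \<rho> - b $ j - of_nat d \<notin> \<int>\<^sub>\<le>\<^sub>0" for \<rho> j
      by (simp add: nd(1))
  qed (rule assms(1))
  note B_iff = is_B_vector_iff[OF rq \<kappa>a \<kappa>b nd(2)]
  define L where "L = word_op a b \<kappa> w (seed a b n m \<gamma>)"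
  define Q where "Q = (\<Prod>c<length w. lin (- (\<kappa> $ (w ! c) + 1 + of_nat (later_count w c))))"
  have "(\<forall>j t. t < 0 \<or> t > int d \<longrightarrow> fls_nth (L $ j) t = 0) \<and>
      symbol a b d (\<lambda>k j. fls_nth (L $ j) (int k)) = Rhat b m d \<gamma> * Q"
    using word_op_invariant[OF nd(2,3) d_def[symmetric] _ assms(7) order_refl, of \<kappa> \<gamma>] assms(4)
    unfolding L_def Q_def word_op_def by simp
  then have supp: "\<And>j t. t < 0 \<or> t > int d \<Longrightarrow> fls_nth (L $ j) t = 0"
    and sym: "symbol a b d (\<lambda>k j. fls_nth (L $ j) (int k)) = Rhat b m d \<gamma> * Q"
    by blast+
  \<comment> \<open>The exponents of L lie between 0 and d, so C is L itself read as a vector of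
    polynomials.\<close>
  define C where "C = (\<chi> j. \<Sum>k\<le>d. monom (fls_nth (L $ j) (int k)) k)"
  have coeff_C: "coeff (C $ j) k = fls_nth (L $ j) (int k)" for j k
    by (auto simp: C_def coeff_sum supp)
  have degree_C: "degree (C $ j) \<le> d" for j
    by (rule degree_le) (simp add: coeff_C supp)
  have laurent_C: "laurent_of_polys C $ j = L $ j" for j
    by (rule fls_eqI) (auto simp: laurent_of_polys_def coeff_C supp)
  have sym_C: "symbol a b d (\<lambda>k j. coeff (C $ j) k) = Rhat b m d \<gamma> * Q"
    by (simp add: coeff_C sym)
  \<comment> \<open>Up to a nonzero factor the top coefficient is the symbol at - b_j - d. There Q
    is nonzero by admissibility, and \<open>Rhat\<close> vanishes exactly when m_j = d, since the
    b_h are distinct and \<gamma> \<noteq> 0.\<close>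
  have top_C: "coeff (C $ j) d = 0 \<longleftrightarrow> m $ j = d" for j
  proof -
    let ?u = "- b $ j - of_nat d"
    have Q: "poly Q ?u \<noteq> 0"
    proof -
      have "?u + - (\<kappa> $ i + 1 + of_nat l) \<noteq> 0" for i l
      proof -
        have "?u + - (\<kappa> $ i + 1 + of_nat l) = - (\<kappa> $ i + b $ j + 1 + of_nat (l + d))" by simp
        then show ?thesis
          using add_nat_notin_nonpos_Ints[OF \<kappa>b[of i j], of "l + d"] by (metis neg_equal_0_iff_equal zero_in_nonpos_Ints)
      qed
      then show ?thesis
        unfolding Q_def poly_prod poly_lin prod_zero_iff[OF finite_lessThan] by blast
    qed
    have R: "poly (Rhat b m d \<gamma>) ?u = 0 \<longleftrightarrow> m $ j = d"
    proof -
      have "poly (Rhat b m d \<gamma>) ?u = \<gamma> * (\<Prod>h\<in>{h. m $ h = d}. b $ h - b $ j)"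
        by (simp add: Rhat_def poly_prod)
      also have "\<dots> = 0 \<longleftrightarrow> m $ j = d"
        using assms(6) inj_b by (auto simp: inj_eq)
      finally show ?thesis .
    qed
    have "poly (Rhat b m d \<gamma>) ?u * poly Q ?u = coeff (C $ j) d * poly (Psi a b d d j) ?u"
      using poly_symbol_top[of "\<lambda>k j. coeff (C $ j) k" j] by (simp add: sym_C)
    then have "coeff (C $ j) d = 0 \<longleftrightarrow> poly (Rhat b m d \<gamma>) ?u * poly Q ?u = 0"
      using Psi_pole[of d j] by simp
    with Q R show ?thesis by simp
  qed
  have nodes_C: "poly (symbol a b d (\<lambda>k j. coeff (C $ j) k)) u = 0" if node: "u \<in> nodes \<kappa> n" for u
  proof -
    obtain i l where u: "u = \<kappa> $ i + of_nat l + 1" and "l < n $ i"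
      using node by (auto simp: nodes_def)
    then have "l < count_list w i" using assms(8) by simp
    then obtain c where c: "c < length w" "w ! c = i" "later_count w c = l"
      using ex_later_count[of l w i] by auto
    have factor: "poly (lin (- (\<kappa> $ (w ! c) + 1 + of_nat (later_count w c)))) u = 0"
      by (simp add: c u)
    have "poly Q u = 0"
      unfolding Q_def poly_prod
      by (rule prod_zero[OF finite_lessThan bexI[of _ c]], rule factor) (simp add: c)
    then show ?thesis by (simp add: sym_C)
  qed
  \<comment> \<open>Proved for all multiples at once: c = 1 gives existence, the inverse leading
    coefficient gives the monic vector.\<close>
  have is_B_C: "is_B_vector a b \<kappa> n m (\<chi> j. smult c (C $ j))" if "c \<noteq> 0" for c
  proof -
    obtain j0 where "m $ j0 = Suc d" using nd(3) by blast
    then have "C $ j0 \<noteq> 0" using top_C[of j0] by auto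
    then have "(\<chi> j. smult c (C $ j)) \<noteq> 0"
      using that by (auto simp: vec_eq_iff)
    moreover have "symbol a b d (\<lambda>k j. c * coeff (C $ j) k) = smult c (Rhat b m d \<gamma> * Q)"
      by (simp only: symbol_smult sym_C)
    moreover have "degree (smult c (C $ j)) \<le> d" for j
      by (rule order.trans[OF degree_smult_le degree_C])
    moreover have "m $ j = d \<Longrightarrow> coeff (C $ j) d = 0" for j
      by (simp only: top_C)
    ultimately show ?thesis
      unfolding B_iff using nodes_C by (simp add: sym_C)
  qed
  have scalar: "\<exists>c. c \<noteq> 0 \<and> (\<forall>j. B $ j = smult c (C $ j))" if "is_B_vector a b \<kappa> n m B" for B
  proof -
    from that have B: "B \<noteq> 0" "\<And>j. degree (B $ j) \<le> d" "\<And>j. m $ j = d \<Longrightarrow> coeff (B $ j) d = 0"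
      "\<And>u. u \<in> nodes \<kappa> n \<Longrightarrow> poly (symbol a b d (\<lambda>k j. coeff (B $ j) k)) u = 0"
      by (auto simp: B_iff)
    obtain j0 where j0: "m $ j0 = Suc d" using nd(3) by blast
    then have C0: "coeff (C $ j0) d \<noteq> 0" using top_C[of j0] by simp
    \<comment> \<open>This choice cancels the top coefficient of B - cC at j0, which supplies the
      one root still missing in the count.\<close>
    define c where "c = coeff (B $ j0) d / coeff (C $ j0) d"
    define p where "p = (\<lambda>k j. coeff (B $ j) k - c * coeff (C $ j) k)"
    have "symbol a b d p = 0"
    proof (rule symbol_eq_0I[OF nd(2)])
      show "msize m = Suc (card (nodes \<kappa> n))" using card_nodes[OF \<kappa>] assms(4) by simp
      show "poly (symbol a b d p) u = 0" if "u \<in> nodes \<kappa> n" for u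
        using B(4)[OF that] nodes_C[OF that] by (simp add: p_def symbol_diff symbol_smult)
      show "u + b $ h + of_nat d \<noteq> 0" if "u \<in> nodes \<kappa> n" for u h
        using nodes_avoid_poles[OF \<kappa>b that] .
      show "p d j = 0" if "m $ j = d" for j using B(3) top_C that by (simp add: p_def)
      show "m $ j0 = Suc d" by (rule j0)
      show "p d j0 = 0" using C0 by (simp add: p_def c_def)
    qed simp
    then have p: "p k j = 0" if "k \<le> d" for k j using symbol_eq_0D that by blast
    have "B $ j = smult c (C $ j)" for j
    proof (rule poly_eqI)
      fix k
      show "coeff (B $ j) k = coeff (smult c (C $ j)) k"
      proof (cases "k \<le> d")
        case True
        then show ?thesis using p[of k j] by (simp add: p_def)
      next
        case False
        then show ?thesis
          using B(2)[of j] degree_C[of j] by (simp add: coeff_eq_0)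
      qed
    qed
    moreover from this B(1) have "c \<noteq> 0" by (auto simp: vec_eq_iff)
    ultimately show ?thesis by blast
  qed
  show ?thesis
  proof (intro conjI allI impI)
    show "\<exists>B. is_B_vector a b \<kappa> n m B" using is_B_C[OF one_neq_zero] by (rule exI)
  next
    fix B assume "is_B_vector a b \<kappa> n m B"
    then obtain c where c: "c \<noteq> 0" "\<And>j. B $ j = smult c (C $ j)" using scalar by blast
    have "laurent_of_polys B $ j = fls_const c * laurent_of_polys C $ j" for j
      by (rule fls_eqI) (simp add: laurent_of_polys_def c(2))
    then show "\<exists>c. c \<noteq> 0 \<and> (\<forall>j. laurent_of_polys B $ j =
        fls_const c * word_op a b \<kappa> w (seed a b n m \<gamma>) $ j)"
      using c(1) by (auto simp: laurent_C L_def)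
  next
    fix j assume "m $ j = max_entry m"
    \<comment> \<open>A maximal m_j equals d + 1, so the coefficient of C_j at d is nonzero.\<close>
    then have "C $ j \<noteq> 0" using top_C[of j] nd(1) by auto
    then have lc: "lead_coeff (C $ j) \<noteq> 0" by simp
    show "\<exists>!B. is_B_vector a b \<kappa> n m B \<and> lead_coeff (B $ j) = 1"
    proof (rule ex1I)
      show "is_B_vector a b \<kappa> n m (\<chi> h. smult (1 / lead_coeff (C $ j)) (C $ h)) \<and>
          lead_coeff ((\<chi> h. smult (1 / lead_coeff (C $ j)) (C $ h)) $ j) = 1"
        using is_B_C[of "1 / lead_coeff (C $ j)"] lc by (simp add: lead_coeff_smult)
    next
      fix B assume B: "is_B_vector a b \<kappa> n m B \<and> lead_coeff (B $ j) = 1"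
      then obtain c where c: "\<And>j. B $ j = smult c (C $ j)" using scalar by blast
      have "lead_coeff (B $ j) = c * lead_coeff (C $ j)"
        unfolding c by (rule lead_coeff_smult)
      then have "c * lead_coeff (C $ j) = 1" using B by simp
      then have "c = 1 / lead_coeff (C $ j)" using lc by (simp add: field_simps)
      with c show "B = (\<chi> h. smult (1 / lead_coeff (C $ j)) (C $ h))"
        by (simp add: vec_eq_iff)
    qed
  qed
qed

end
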